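(* Let $1<p<\infty$, $\beta>-n$, $\lambda=(\lambda_1,\lambda_2)\in\mathbb{R}^2$, and $-\lambda_2 \beta/n< \lambda_1 + \lambda_2 < n$. The Hardy–Littlewood maximal operator $M$ is bounded on $\mathcal L^{p,\lambda}(|x|^\beta)$ if and only if $$\lambda_1+\lambda_2 -n \le \beta \left(1-\frac {\lambda_2} n\right)<\lambda_1+\lambda_2 + n(p-1).$$ For $p=1$ the same holds as a weak-type estimate: $M$ is bounded from $\mathcal L^{1,\lambda}(|x|^\beta)$ to $W\mathcal L^{1,\lambda}(|x|^\beta)$ if and only if the displayed condition holds with $p=1$.
   Context: For a weight $w$ on $\mathbb{R}^n$, $w(E)=\int_E w$; $|E|$ is Lebesgue measure, $B(x,r)$ is the Euclidean ball. For $0<p<\infty$ and $\lambda=(\lambda_1,\lambda_2)$, $\mathcal L^{p,\lambda}(w)$ and $W\mathcal L^{p,\lambda}(w)$ are the spaces of measurable $f$ for which, respectively, $$\|f\|_{\mathcal L^{p,\lambda}(w)} := \sup_{x\in \mathbb{R}^n,\, r>0}\left(\frac 1{r^{\lambda_1}\, w(B(x,r))^{\lambda_2/n}}\int_{B(x,r)}|f|^p w\right)^{1/p}<\infty,$$ $$\|f\|_{W\mathcal L^{p,\lambda}(w)}:=\sup_{x\in \mathbb{R}^n,\, r>0,\, t>0}\left(\frac {t^p\,w(\{y\in B(x,r): |f(y)|>t\})}{|B(x,r)|^{\lambda_1/n}\, w(B(x,r))^{\lambda_2/n}}\right)^{1/p}<\infty.$$ $|x|^\beta$ denotes the power weight $x\mapsto|x|^\beta$.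 $Mf(x)=\sup_{B\ni x}\frac1{|B|}\int_B|f|$ over balls $B$ containing $x$. Boundedness means a norm inequality with constant independent of $f$. *)

theory Defs
  imports "HOL-Analysis.Analysis"
begin

text \<open>
  Functions on \<open>\<real>\<^sup>n\<close> (a Euclidean space of dimension \<open>DIM('a)\<close>) take values in
  \<open>[-\<infinity>, \<infinity>]\<close>, so that the maximal function of \<open>f\<close> is a function of the same kind as \<open>f\<close>.
  Integrals, suprema and norms are formed in \<open>[0, \<infinity>]\<close>.
\<close>

text \<open>Real powers on \<open>[0, \<infinity>]\<close>, with \<open>x\<^sup>0 = 1\<close>.\<close>

definition ennpow :: "ennreal \<Rightarrow> real \<Rightarrow> ennreal" where
  "ennpow x a =
    (if a = 0 then 1
     else if x = 0 then (if a < 0 then top else 0)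
     else if x = top then (if a < 0 then 0 else top)
     else ennreal (enn2real x powr a))"

text \<open>
  The value at the origin, which is \<open>0\<close> also for \<open>\<beta> \<le> 0\<close> by the convention \<open>0 powr \<beta> = 0\<close>,
  is immaterial: weights only occur under integrals.
\<close>

definition power_weight :: "real \<Rightarrow> 'a::euclidean_space \<Rightarrow> real" where
  "power_weight \<beta> x = norm x powr \<beta>"

definition weight_measure :: "('a::euclidean_space \<Rightarrow> real) \<Rightarrow> 'a set \<Rightarrow> ennreal" where
  "weight_measure w E = (\<integral>\<^sup>+ y \<in> E. ennreal (w y) \<partial>lebesgue)"

definition morrey_norm ::
  "real \<Rightarrow> real \<Rightarrow> real \<Rightarrow> ('a::euclidean_space \<Rightarrow> real) \<Rightarrow> ('a \<Rightarrow> ereal) \<Rightarrow> ennreal" where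
  "morrey_norm p l\<^sub>1 l\<^sub>2 w f =
    (SUP x. SUP r \<in> {0<..}.
       ennpow
         ((\<integral>\<^sup>+ y \<in> ball x r. ennpow (e2ennreal \<bar>f y\<bar>) p * ennreal (w y) \<partial>lebesgue) /
          (ennreal (r powr l\<^sub>1) * ennpow (weight_measure w (ball x r)) (l\<^sub>2 / real DIM('a))))
         (1 / p))"

definition morrey_space ::
  "real \<Rightarrow> real \<Rightarrow> real \<Rightarrow> ('a::euclidean_space \<Rightarrow> real) \<Rightarrow> ('a \<Rightarrow> ereal) set" where
  "morrey_space p l\<^sub>1 l\<^sub>2 w =
    {f \<in> borel_measurable lebesgue. morrey_norm p l\<^sub>1 l\<^sub>2 w f < top}"

definition weak_morrey_norm ::
  "real \<Rightarrow> real \<Rightarrow> real \<Rightarrow> ('a::euclidean_space \<Rightarrow> real) \<Rightarrow> ('a \<Rightarrow> ereal) \<Rightarrow> ennreal" where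
  "weak_morrey_norm p l\<^sub>1 l\<^sub>2 w f =
    (SUP x. SUP r \<in> {0<..}. SUP t \<in> {0<..}.
       ennpow
         ((ennreal (t powr p) * weight_measure w {y \<in> ball x r. ereal t < \<bar>f y\<bar>}) /
          (ennpow (emeasure lebesgue (ball x r)) (l\<^sub>1 / real DIM('a)) *
           ennpow (weight_measure w (ball x r)) (l\<^sub>2 / real DIM('a))))
         (1 / p))"

definition weak_morrey_space ::
  "real \<Rightarrow> real \<Rightarrow> real \<Rightarrow> ('a::euclidean_space \<Rightarrow> real) \<Rightarrow> ('a \<Rightarrow> ereal) set" where
  "weak_morrey_space p l\<^sub>1 l\<^sub>2 w =
    {f \<in> borel_measurable lebesgue. weak_morrey_norm p l\<^sub>1 l\<^sub>2 w f < top}"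

definition hl_maximal :: "('a::euclidean_space \<Rightarrow> ereal) \<Rightarrow> 'a \<Rightarrow> ereal" where
  "hl_maximal f x =
    enn2ereal (SUP (c, r) \<in> {(c, r). 0 < r \<and> x \<in> ball c r}.
      (\<integral>\<^sup>+ y \<in> ball c r. e2ennreal \<bar>f y\<bar> \<partial>lebesgue) / emeasure lebesgue (ball c r))"

definition bounded_operator ::
  "('f \<Rightarrow> 'g) \<Rightarrow> 'f set \<Rightarrow> ('f \<Rightarrow> ennreal) \<Rightarrow> 'g set \<Rightarrow> ('g \<Rightarrow> ennreal) \<Rightarrow> bool" where
  "bounded_operator T X N Y N' \<longleftrightarrow>
    (\<forall>f \<in> X. T f \<in> Y) \<and> (\<exists>C::real. \<forall>f \<in> X. N' (T f) \<le> ennreal C * N f)"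

end

theory Submission
  imports Defs
begin

text \<open>
  Write \<open>a = \<lambda>\<^sub>1 + \<lambda>\<^sub>2\<close>, \<open>b = \<beta> \<lambda>\<^sub>2 / n\<close> and \<open>e = a + b - \<beta> - n\<close>. Since the weight of \<open>B(x, r)\<close> is
  comparable to \<open>r\<^sup>n (|x| + r)\<^sup>\<beta>\<close>, the denominators of both norms are comparable to
  \<open>r\<^sup>a (|x| + r)\<^sup>b\<close>, and the condition on the exponents reads \<open>e \<le> 0 < e + n p\<close>.

  Necessity: \<open>f(y) = |y|\<^bsup>e/p\<^esup>\<close> always lies in the space. If \<open>e > 0\<close> its averages over large balls
  are unbounded, and if \<open>e / p \<le> -n\<close> it is not integrable at the origin; either way
  \<open>M f = \<infinity>\<close> everywhere.

  Sufficiency: the lower bound on \<open>e\<close> makes the integrals of \<open>f\<close> over dyadic shells summable towards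
  the origin, and the upper bound then controls the averages of \<open>f\<close> over all balls around \<open>y\<close> of
  radius comparable to \<open>|y|\<close> or larger by \<open>|y|\<^bsup>e/p\<^esup>\<close>. Smaller balls only see a region where the
  weight is essentially constant, so that the unweighted maximal theorem applies, on dyadic shells
  and on balls far from the origin; balls near the origin are exhausted by shells because
  \<open>a + b > 0\<close>.
\<close>

section \<open>The maximal function and its weak type estimate\<close>

text \<open>The exponent e is dictated by scaling. A Morrey bound A on the ball of radius s around
  the origin, divided by the weight s^\<beta> and the volume s^n, leaves f^p a mean of order A s^e
  on the shell of size s. So |y|^(e/p) is the extremal profile, and \<open>e + n p > 0\<close> says
  that n + e/p, the exponent of the integral of f over a shell, is positive. The hypothesis a < n
  enters through the balls between the two regimes: for y in B(x, r) far from the origin, balls of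
  radius \<rho> between r and |x| give f^p means of order \<rho>^(a - n) |x|^(b - \<beta>), which
  are worst at \<rho> = r because a - n < 0. The same monotonicity puts |y|^(e/p) into the space.
  Truncation at a single height, with loss of a factor 2, takes the place of Hoelder's inequality
  and covers p = 1 as well. Necessity rests on the mapping property alone, not on the norm
  inequality: M f = \<infinity> everywhere lies in neither target space.\<close>

lemma ennpow_ennreal: "0 < x \<Longrightarrow> ennpow (ennreal x) a = ennreal (x powr a)"
  by (simp add: ennpow_def)

lemma ennpow_ennreal_nonneg: "0 \<le> x \<Longrightarrow> 0 < a \<Longrightarrow> ennpow (ennreal x) a = ennreal (x powr a)"
  by (auto simp: ennpow_def)

lemma ennpow_top: "0 < a \<Longrightarrow> ennpow top a = top"
  by (simp add: ennpow_def)

lemma ennpow_one: "ennpow x 1 = x"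
  by (cases x) (auto simp: ennpow_def)

lemma ennpow_measurable [measurable]: "(\<lambda>x. ennpow x a) \<in> borel_measurable borel"
  unfolding ennpow_def by measurable

lemma unit_ball_vol_neq_0 [simp]: "0 \<le> n \<Longrightarrow> unit_ball_vol n \<noteq> 0"
  by (metis less_irrefl unit_ball_vol_pos)

lemma emeasure_ball_powr:
  fixes c :: "'a::euclidean_space"
  assumes "0 < r"
  shows "emeasure lborel (ball c r) = ennreal (unit_ball_vol DIM('a) * r powr DIM('a))"
    and "emeasure lborel (cball c r) = ennreal (unit_ball_vol DIM('a) * r powr DIM('a))"
  using assms emeasure_ball[of r c] emeasure_cball[of r c] by (simp_all add: powr_realpow)

text \<open>Countable subadditivity with the sum written as an integral, because the Vitali covering
  lemma supplies a countable set of balls, possibly finite, without an enumeration.\<close>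

lemma emeasure_UN_le_nn_integral_count_space:
  assumes "countable C" "\<And>i. i \<in> C \<Longrightarrow> X i \<in> sets M"
  shows "emeasure M (\<Union>i\<in>C. X i) \<le> (\<integral>\<^sup>+ i. emeasure M (X i) \<partial>count_space C)"
proof -
  have "emeasure M (\<Union>i\<in>C. X i) = (\<integral>\<^sup>+ x. indicator (\<Union>i\<in>C. X i) x \<partial>M)"
    using assms by (intro nn_integral_indicator[symmetric] sets.countable_UN') auto
  also have "\<dots> \<le> (\<integral>\<^sup>+ x. (\<integral>\<^sup>+ i. indicator (X i) x \<partial>count_space C) \<partial>M)"
  proof (intro nn_integral_mono)
    fix x
    show "indicator (\<Union>i\<in>C. X i) x \<le> (\<integral>\<^sup>+ i. indicator (X i) x \<partial>count_space C)"
    proof (cases "x \<in> (\<Union>i\<in>C. X i)")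
      case True
      then obtain i where "i \<in> C" "x \<in> X i"
        by auto
      then show ?thesis
        using nn_integral_ge_point[of i C "\<lambda>i. indicator (X i) x"] True by auto
    qed simp
  qed
  also have "\<dots> = (\<integral>\<^sup>+ i. (\<integral>\<^sup>+ x. indicator (X i) x \<partial>M) \<partial>count_space C)"
    using assms by (intro nn_integral_count_space_nn_integral) auto
  also have "\<dots> = (\<integral>\<^sup>+ i. emeasure M (X i) \<partial>count_space C)"
    using assms by (intro nn_integral_cong) auto
  finally show ?thesis .
qed

section \<open>The uncentred maximal function and the Vitali covering argument\<close>

text \<open>The supremum of \<open>hl_maximal\<close> for functions with values in [0, \<infinity>],
  free of absolute values and of coercions from \<open>ereal\<close>.\<close>

definition maximal :: "('a::euclidean_space \<Rightarrow> ennreal) \<Rightarrow> 'a \<Rightarrow> ennreal" where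
  "maximal g x = (SUP (c, r) \<in> {(c, r). 0 < r \<and> x \<in> ball c r}.
    (\<integral>\<^sup>+ y \<in> ball c r. g y \<partial>lebesgue) / emeasure lebesgue (ball c r))"

lemma hl_maximal_eq: "hl_maximal f x = enn2ereal (maximal (\<lambda>y. e2ennreal \<bar>f y\<bar>) x)"
  by (simp add: hl_maximal_def maximal_def)

lemma maximal_leI:
  fixes g :: "'a::euclidean_space \<Rightarrow> ennreal"
  assumes "\<And>c r. 0 < r \<Longrightarrow> x \<in> ball c r \<Longrightarrow>
    (\<integral>\<^sup>+ y \<in> ball c r. g y \<partial>lebesgue) \<le> K * ennreal (unit_ball_vol DIM('a) * r powr DIM('a))"
  shows "maximal g x \<le> K"
  unfolding maximal_def
proof (safe intro!: SUP_least)
  fix c :: 'a and r :: real assume "0 < r" "x \<in> ball c r"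
  with assms[OF this] show "(\<integral>\<^sup>+ y \<in> ball c r. g y \<partial>lebesgue) / emeasure lebesgue (ball c r) \<le> K"
    by (intro divide_le_posI_ennreal) (auto simp: emeasure_ball_powr mult.commute)
qed

lemma le_maximal:
  fixes g :: "'a::euclidean_space \<Rightarrow> ennreal"
  assumes "0 < r" "x \<in> ball c r"
  shows "(\<integral>\<^sup>+ y \<in> ball c r. g y \<partial>lebesgue) \<le> maximal g x * ennreal (unit_ball_vol DIM('a) * r powr DIM('a))"
proof -
  have le: "(\<integral>\<^sup>+ y \<in> ball c r. g y \<partial>lebesgue) / emeasure lebesgue (ball c r) \<le> maximal g x"
    unfolding maximal_def by (rule SUP_upper2[of "(c, r)"]) (use assms in auto)
  show ?thesis
    using mult_right_mono[OF le, of "emeasure lebesgue (ball c r)"] assms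
    by (simp add: emeasure_ball_powr ennreal_divide_times divide_ennreal)
qed

lemma less_maximalD:
  fixes g :: "'a::euclidean_space \<Rightarrow> ennreal"
  assumes "t < maximal g x"
  shows "\<exists>c r. 0 < r \<and> x \<in> ball c r \<and> t * emeasure lebesgue (ball c r) \<le> (\<integral>\<^sup>+ y \<in> ball c r. g y \<partial>lebesgue)
    \<and> t < (\<integral>\<^sup>+ y \<in> ball c r. g y \<partial>lebesgue) / emeasure lebesgue (ball c r)"
proof -
  from assms obtain c r where cr: "0 < r" "x \<in> ball c r"
    "t < (\<integral>\<^sup>+ y \<in> ball c r. g y \<partial>lebesgue) / emeasure lebesgue (ball c r)"
    unfolding maximal_def less_SUP_iff by auto
  have "t * emeasure lebesgue (ball c r) \<le> (\<integral>\<^sup>+ y \<in> ball c r. g y \<partial>lebesgue)"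
    using mult_right_mono[OF less_imp_le[OF cr(3)], of "emeasure lebesgue (ball c r)"] cr(1)
    by (simp add: emeasure_ball_powr ennreal_divide_times divide_ennreal)
  with cr show ?thesis
    by blast
qed

text \<open>The maximal function is uncentred: a ball that witnesses a large average at one of its
  points witnesses it at all of them.\<close>

lemma open_maximal_greater:
  fixes g :: "'a::euclidean_space \<Rightarrow> ennreal"
  shows "open {x. t < maximal g x}"
proof (rule Topological_Spaces.openI)
  fix x assume "x \<in> {x. t < maximal g x}"
  then obtain c r where cr: "0 < r" "x \<in> ball c r"
    "t < (\<integral>\<^sup>+ y \<in> ball c r. g y \<partial>lebesgue) / emeasure lebesgue (ball c r)"
    using less_maximalD by blast
  have "ball c r \<subseteq> {x. t < maximal g x}"
  proof
    fix y assume y: "y \<in> ball c r"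
    have "(\<integral>\<^sup>+ y \<in> ball c r. g y \<partial>lebesgue) / emeasure lebesgue (ball c r) \<le> maximal g y"
      unfolding maximal_def by (rule SUP_upper2[of "(c, r)"]) (use cr y in auto)
    with cr show "y \<in> {x. t < maximal g x}"
      by auto
  qed
  with cr show "\<exists>T. open T \<and> x \<in> T \<and> T \<subseteq> {x. t < maximal g x}"
    by (intro exI[of _ "ball c r"]) auto
qed

lemma maximal_measurable [measurable]:
  fixes g :: "'a::euclidean_space \<Rightarrow> ennreal"
  shows "maximal g \<in> borel_measurable borel"
  by (rule borel_measurableI_greater) (auto intro: borel_open open_maximal_greater)

lemma maximal_measurable_lebesgue [measurable]:
  fixes g :: "'a::euclidean_space \<Rightarrow> ennreal"
  shows "maximal g \<in> borel_measurable lebesgue"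
  by (intro measurable_completion) simp

text \<open>Vitali covering. Balls whose average is at least t cover the level set; if g is
  integrable their radii are bounded, so a countable disjoint subfamily exists whose fivefold
  enlargements still cover. Dilation by 5 costs 5^n in volume.\<close>

lemma maximal_weak_type:
  fixes g :: "'a::euclidean_space \<Rightarrow> ennreal"
  assumes g [measurable]: "g \<in> borel_measurable lebesgue" and t: "0 < t"
  shows "ennreal t * emeasure lebesgue {x. ennreal t < maximal g x}
    \<le> ennreal (5 powr DIM('a)) * (\<integral>\<^sup>+ y. g y \<partial>lebesgue)"
proof (cases "(\<integral>\<^sup>+ y. g y \<partial>lebesgue)")
  case top
  then show ?thesis by (simp add: ennreal_mult_top)
next
  case (real I)
  define n :: real where "n = DIM('a)"
  have n: "1 \<le> n" by (simp add: n_def Suc_leI)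
  define \<omega> where "\<omega> = unit_ball_vol n"
  have \<omega>: "0 < \<omega>" using n by (simp add: \<omega>_def)
  define K :: "('a \<times> real) set" where "K = {(c, r). 0 < r \<and>
     ennreal t * emeasure lebesgue (ball c r) \<le> (\<integral>\<^sup>+ y \<in> ball c r. g y \<partial>lebesgue)}"
  \<comment> \<open>Only some bound on the radii is needed. Since n \<ge> 1, a radius above 1
    satisfies r \<le> r^n, so no n-th root has to be taken.\<close>
  define B where "B = max 1 (I / (t * \<omega>))"
  have bound: "0 < snd i \<and> snd i \<le> B" if "i \<in> K" for i
  proof -
    obtain c r where i: "i = (c, r)" by force
    have r: "0 < r" and le: "ennreal t * emeasure lebesgue (ball c r) \<le> (\<integral>\<^sup>+ y \<in> ball c r. g y \<partial>lebesgue)"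
      using that by (auto simp: K_def i)
    have "(\<integral>\<^sup>+ y \<in> ball c r. g y \<partial>lebesgue) \<le> ennreal I"
      unfolding real(2)[symmetric] by (intro nn_integral_mono) (auto split: split_indicator)
    with le have "ennreal (t * (\<omega> * r powr n)) \<le> ennreal I"
      using t r \<omega> by (simp add: emeasure_ball_powr ennreal_mult n_def \<omega>_def)
    then have "t * \<omega> * r powr n \<le> I"
      using real by (simp add: mult.assoc)
    then have *: "r powr n \<le> I / (t * \<omega>)"
      using t \<omega> by (simp add: field_simps)
    have "r \<le> B"
    proof (cases "r \<le> 1")
      case False
      then have "r powr 1 \<le> r powr n"
        using n by (intro powr_mono) auto
      with * False show ?thesis by (auto simp: B_def)
    qed (auto simp: B_def)
    with r show ?thesis by (simp add: i)
  qed
  have cover: "{x. ennreal t < maximal g x} \<subseteq> (\<Union>i\<in>K. cball (fst i) (snd i))"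
  proof
    fix x assume "x \<in> {x. ennreal t < maximal g x}"
    then obtain c r where "0 < r" "x \<in> ball c r"
      "ennreal t * emeasure lebesgue (ball c r) \<le> (\<integral>\<^sup>+ y \<in> ball c r. g y \<partial>lebesgue)"
      using less_maximalD by blast
    then have "(c, r) \<in> K" "x \<in> cball (fst (c, r)) (snd (c, r))"
      by (auto simp: K_def)
    then show "x \<in> (\<Union>i\<in>K. cball (fst i) (snd i))"
      by blast
  qed
  obtain C where C: "countable C" "C \<subseteq> K"
    "pairwise (\<lambda>i j. disjnt (cball (fst i) (snd i)) (cball (fst j) (snd j))) C"
    "{x. ennreal t < maximal g x} \<subseteq> (\<Union>i\<in>C. cball (fst i) (5 * snd i))"
    using Vitali_covering_lemma_cballs[OF cover bound] by blast
  have disj: "disjoint_family_on (\<lambda>i. ball (fst i) (snd i)) C"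
    unfolding disjoint_family_on_def
  proof (intro ballI impI)
    fix i j assume "i \<in> C" "j \<in> C" "i \<noteq> j"
    then have "disjnt (cball (fst i) (snd i)) (cball (fst j) (snd j))"
      using C(3) by (auto simp: pairwise_def)
    then show "ball (fst i) (snd i) \<inter> ball (fst j) (snd j) = {}"
      using ball_subset_cball[of "fst i" "snd i"] ball_subset_cball[of "fst j" "snd j"]
      unfolding disjnt_def by blast
  qed
  have "ennreal t * emeasure lebesgue {x. ennreal t < maximal g x}
    \<le> ennreal t * emeasure lebesgue (\<Union>i\<in>C. cball (fst i) (5 * snd i))"
    using C by (intro mult_left_mono emeasure_mono sets.countable_UN') auto
  also have "\<dots> \<le> ennreal t * (\<integral>\<^sup>+ i. emeasure lebesgue (cball (fst i) (5 * snd i)) \<partial>count_space C)"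
    using C by (intro mult_left_mono emeasure_UN_le_nn_integral_count_space) auto
  also have "\<dots> = (\<integral>\<^sup>+ i. ennreal t * emeasure lebesgue (cball (fst i) (5 * snd i)) \<partial>count_space C)"
    by (rule nn_integral_cmult[symmetric]) simp
  \<comment> \<open>Viewing integrals of g as values of a measure with density g lets countable
    additivity merge the disjoint balls below.\<close>
  also have "\<dots> \<le> (\<integral>\<^sup>+ i. ennreal (5 powr n) * emeasure (density lebesgue g) (ball (fst i) (snd i)) \<partial>count_space C)"
  proof (intro nn_integral_mono)
    fix i assume "i \<in> space (count_space C)"
    then have i: "i \<in> K" using C by auto
    have r: "0 < snd i" using bound[OF i] by simp
    have "ennreal t * emeasure lebesgue (cball (fst i) (5 * snd i))
      = ennreal (5 powr n) * (ennreal t * emeasure lebesgue (ball (fst i) (snd i)))"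
      using r t \<omega> by (simp add: emeasure_ball_powr powr_mult
           n_def \<omega>_def mult_ac flip: ennreal_mult)
    also have "\<dots> \<le> ennreal (5 powr n) * (\<integral>\<^sup>+ y \<in> ball (fst i) (snd i). g y \<partial>lebesgue)"
      using i by (intro mult_left_mono) (auto simp: K_def)
    finally show "ennreal t * emeasure lebesgue (cball (fst i) (5 * snd i))
      \<le> ennreal (5 powr n) * emeasure (density lebesgue g) (ball (fst i) (snd i))"
      by (simp add: emeasure_density)
  qed
  also have "\<dots> = ennreal (5 powr n) * (\<integral>\<^sup>+ i. emeasure (density lebesgue g) (ball (fst i) (snd i)) \<partial>count_space C)"
    by (rule nn_integral_cmult) simp
  also have "(\<integral>\<^sup>+ i. emeasure (density lebesgue g) (ball (fst i) (snd i)) \<partial>count_space C)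
    = emeasure (density lebesgue g) (\<Union>i\<in>C. ball (fst i) (snd i))"
    using C disj by (intro emeasure_UN_countable[symmetric]) auto
  also have "\<dots> \<le> (\<integral>\<^sup>+ y. g y \<partial>lebesgue)"
    using C by (subst emeasure_density) (auto intro!: nn_integral_mono sets.countable_UN' split: split_indicator)
  finally show ?thesis
    by (simp add: n_def mult_left_mono)
qed

section \<open>Dyadic decompositions\<close>

text \<open>Above \<tau> the ratio x / \<tau> exceeds 1, so x \<le> x (x / \<tau>)^(p - 1).\<close>

lemma le_truncation_add_power:
  assumes "1 \<le> p" "0 < \<tau>"
  shows "x \<le> ennreal \<tau> + ennreal (\<tau> powr (1 - p)) * ennpow x p"
proof (cases x)
  case top
  then show ?thesis using assms by (simp add: ennpow_top ennreal_mult_top)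
next
  case (real r)
  have "r \<le> \<tau> + \<tau> powr (1 - p) * r powr p"
  proof (cases "r \<le> \<tau>")
    case False
    then have "r = r powr (1 - p) * r powr p"
      using assms by (simp flip: powr_add)
    also have "\<dots> \<le> \<tau> powr (1 - p) * r powr p"
      using assms False by (intro mult_right_mono powr_mono2') auto
    finally show ?thesis using assms by simp
  qed (use assms in \<open>simp add: add_increasing2\<close>)
  with real assms show ?thesis
    by (simp add: ennpow_ennreal_nonneg flip: ennreal_mult ennreal_plus)
qed

text \<open>Jensen's inequality up to the factor 2. Truncating at height T^(1/p) makes both parts
  contribute the same amount. \<open>V\<close> need only bound the measure of S, which spares exact
  volumes.\<close>

lemma set_nn_integral_le_of_power:
  fixes g :: "'a::euclidean_space \<Rightarrow> ennreal"
  assumes [measurable]: "g \<in> borel_measurable lebesgue" "S \<in> sets lebesgue"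
    and "1 \<le> p" "0 < T" "0 < V" "emeasure lebesgue S \<le> ennreal V"
    and I: "(\<integral>\<^sup>+ y \<in> S. ennpow (g y) p \<partial>lebesgue) \<le> ennreal (T * V)"
  shows "(\<integral>\<^sup>+ y \<in> S. g y \<partial>lebesgue) \<le> ennreal (2 * T powr (1 / p) * V)"
proof -
  define \<tau> where "\<tau> = T powr (1 / p)"
  have \<tau>: "0 < \<tau>" using assms by (simp add: \<tau>_def)
  have \<tau>p: "\<tau> powr p = T" using assms by (simp add: \<tau>_def powr_powr)
  have "(\<integral>\<^sup>+ y \<in> S. g y \<partial>lebesgue)
    \<le> (\<integral>\<^sup>+ y. ennreal \<tau> * indicator S y + ennreal (\<tau> powr (1 - p)) * (ennpow (g y) p * indicator S y) \<partial>lebesgue)"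
  proof (intro nn_integral_mono)
    fix y
    show "g y * indicator S y \<le> ennreal \<tau> * indicator S y + ennreal (\<tau> powr (1 - p)) * (ennpow (g y) p * indicator S y)"
      using le_truncation_add_power[OF \<open>1 \<le> p\<close> \<tau>, of "g y"] by (auto split: split_indicator)
  qed
  also have "\<dots> = ennreal \<tau> * emeasure lebesgue S + ennreal (\<tau> powr (1 - p)) * (\<integral>\<^sup>+ y \<in> S. ennpow (g y) p \<partial>lebesgue)"
    by (simp add: nn_integral_add nn_integral_cmult)
  also have "\<dots> \<le> ennreal \<tau> * ennreal V + ennreal (\<tau> powr (1 - p)) * ennreal (T * V)"
    using assms by (intro add_mono mult_left_mono) auto
  also have "\<dots> = ennreal (\<tau> * V + \<tau> powr (1 - p) * (\<tau> powr p * V))"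
    using assms \<tau> by (simp add: \<tau>p flip: ennreal_mult ennreal_plus)
  also have "\<tau> powr (1 - p) * (\<tau> powr p * V) = \<tau> * V"
    using \<tau> by (simp flip: mult.assoc powr_add)
  finally show ?thesis by (simp add: \<tau>_def mult_ac)
qed

section \<open>Dyadic shells around the origin\<close>

text \<open>Half-open, so that the shells of sizes R, R/2, R/4, ... tile the punctured ball.\<close>

definition shell :: "real \<Rightarrow> 'a::euclidean_space set" where
  "shell s = {y. s / 2 \<le> norm y \<and> norm y < s}"

lemma shell_measurable [measurable, simp]: "shell s \<in> sets borel"
  unfolding shell_def by measurable

lemma emeasure_shell_le:
  assumes "0 < s"
  shows "emeasure lebesgue (shell s :: 'a::euclidean_space set) \<le> ennreal (unit_ball_vol DIM('a) * s powr DIM('a))"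
proof -
  have "emeasure lebesgue (shell s :: 'a set) \<le> emeasure lebesgue (ball (0 :: 'a) s)"
    by (intro emeasure_mono) (auto simp: shell_def)
  with assms show ?thesis by (simp add: emeasure_ball_powr)
qed

lemma ball_subset_shells:
  assumes "0 < R"
  shows "ball (0::'a::euclidean_space) R \<subseteq> insert 0 (\<Union>k. shell (R / 2 ^ k))"
proof
  fix y :: 'a assume y: "y \<in> ball 0 R"
  show "y \<in> insert 0 (\<Union>k. shell (R / 2 ^ k))"
  proof (cases "y = 0")
    case False
    obtain m where m: "R / norm y < 2 ^ m"
      using real_arch_pow[of 2 "R / norm y"] by auto
    have ex: "R / 2 ^ m \<le> norm y"
      using m False by (simp add: field_simps)
    define k where "k = (LEAST k. R / 2 ^ k \<le> norm y)"
    have k: "R / 2 ^ k \<le> norm y"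
      unfolding k_def by (rule LeastI[of _ m]) (fact ex)
    have "k \<noteq> 0"
      using k y by (intro notI) simp
    then obtain j where j: "k = Suc j" using not0_implies_Suc by blast
    have "\<not> R / 2 ^ j \<le> norm y"
      using not_less_Least[of j "\<lambda>k. R / 2 ^ k \<le> norm y"] j by (simp add: k_def)
    with k have "y \<in> shell (R / 2 ^ j)"
      by (simp add: shell_def j mult.commute)
    then show ?thesis by blast
  qed simp
qed

text \<open>A geometric series of ratio \<open>2 powr - \<delta>\<close>, the origin being a null
  set. It is applied with the exponents n + \<sigma>, n + e/p and a + b, and is the place where
  their positivity matters.\<close>

lemma set_nn_integral_ball_le_of_shells:
  fixes h :: "'a::euclidean_space \<Rightarrow> ennreal"
  assumes [measurable]: "h \<in> borel_measurable lebesgue"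
    and "0 < \<delta>" "0 \<le> K" "0 < R"
    and shells: "\<And>s. 0 < s \<Longrightarrow> s \<le> R \<Longrightarrow> (\<integral>\<^sup>+ y \<in> shell s. h y \<partial>lebesgue) \<le> ennreal (K * s powr \<delta>)"
  shows "(\<integral>\<^sup>+ y \<in> ball 0 R. h y \<partial>lebesgue) \<le> ennreal (K / (1 - 2 powr - \<delta>) * R powr \<delta>)"
proof -
  define \<nu> where "\<nu> = density lebesgue h"
  have [simp]: "sets \<nu> = sets lebesgue" by (simp add: \<nu>_def)
  have \<nu>: "emeasure \<nu> A = (\<integral>\<^sup>+ y \<in> A. h y \<partial>lebesgue)" if "A \<in> sets lebesgue" for A
    using that by (simp add: \<nu>_def emeasure_density)
  have q: "\<bar>2 powr - \<delta>\<bar> < 1"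
    using \<open>0 < \<delta>\<close> by (simp add: powr_less_one)
  have zero: "emeasure \<nu> {0} = 0"
    by (subst \<nu>) (auto intro!: nn_integral_null_set simp flip: negligible_iff_null_sets)
  have "(\<integral>\<^sup>+ y \<in> ball 0 R. h y \<partial>lebesgue) = emeasure \<nu> (ball 0 R)"
    by (simp add: \<nu>)
  also have "\<dots> \<le> emeasure \<nu> ({0} \<union> (\<Union>k. shell (R / 2 ^ k)))"
    using ball_subset_shells[OF \<open>0 < R\<close>, where 'a = 'a] by (intro emeasure_mono) auto
  also have "\<dots> \<le> emeasure \<nu> {0} + emeasure \<nu> (\<Union>k. shell (R / 2 ^ k))"
    by (intro emeasure_subadditive) auto
  also have "\<dots> \<le> 0 + (\<Sum>k. emeasure \<nu> (shell (R / 2 ^ k)))"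
    unfolding zero by (intro add_left_mono emeasure_subadditive_countably) auto
  also have "\<dots> \<le> (\<Sum>k. ennreal (K * R powr \<delta> * (2 powr - \<delta>) ^ k))"
    unfolding add_0
  proof (intro suminf_le summableI)
    fix k
    have "R / 2 ^ k \<le> R"
      using \<open>0 < R\<close> by (simp add: divide_le_eq mult_le_cancel_left1)
    moreover have "(R / 2 ^ k) powr \<delta> = R powr \<delta> * (2 powr - \<delta>) ^ k"
      using \<open>0 < R\<close> by (simp add: powr_divide powr_minus powr_realpow[symmetric] powr_powr field_simps)
    ultimately show "emeasure \<nu> (shell (R / 2 ^ k)) \<le> ennreal (K * R powr \<delta> * (2 powr - \<delta>) ^ k)"
      using shells[of "R / 2 ^ k"] \<open>0 < R\<close> by (simp add: \<nu> mult.assoc)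
  qed
  also have "\<dots> = ennreal (\<Sum>k. K * R powr \<delta> * (2 powr - \<delta>) ^ k)"
    using assms q by (intro suminf_ennreal2 summable_mult summable_geometric) auto
  also have "(\<Sum>k. K * R powr \<delta> * (2 powr - \<delta>) ^ k) = K * R powr \<delta> * (1 / (1 - 2 powr - \<delta>))"
    using q by (simp add: suminf_mult summable_geometric suminf_geometric)
  finally show ?thesis by simp
qed

section \<open>Ingredients of dyadic Marcinkiewicz interpolation\<close>

text \<open>Values of g up to t/2 add at most t/2 to any average, so an average above t forces the
  part of g above t/2 to have an average above t/2.\<close>

lemma maximal_weak_type_truncated:
  fixes g :: "'a::euclidean_space \<Rightarrow> ennreal"
  assumes [measurable]: "g \<in> borel_measurable lebesgue" and t: "0 < t"
  shows "ennreal (t / 2) * emeasure lebesgue {x. ennreal t < maximal g x}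
    \<le> ennreal (5 powr DIM('a)) * (\<integral>\<^sup>+ y. g y * indicator {ennreal (t / 2)<..} (g y) \<partial>lebesgue)"
proof -
  define h where "h y = g y * indicator {ennreal (t / 2)<..} (g y)" for y
  have [measurable]: "h \<in> borel_measurable lebesgue"
    unfolding h_def by measurable
  have le: "maximal g x \<le> maximal h x + ennreal (t / 2)" for x
  proof (rule maximal_leI)
    fix c :: 'a and r :: real assume r: "0 < r" "x \<in> ball c r"
    have [measurable]: "ball c r \<in> sets lebesgue" by simp
    have "(\<integral>\<^sup>+ y \<in> ball c r. g y \<partial>lebesgue)
      \<le> (\<integral>\<^sup>+ y. h y * indicator (ball c r) y + ennreal (t / 2) * indicator (ball c r) y \<partial>lebesgue)"
      by (intro nn_integral_mono) (auto simp: h_def not_less split: split_indicator)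
    also have "\<dots> = (\<integral>\<^sup>+ y \<in> ball c r. h y \<partial>lebesgue) + ennreal (t / 2) * emeasure lebesgue (ball c r)"
      by (simp add: nn_integral_add nn_integral_cmult)
    also have "\<dots> \<le> (maximal h x + ennreal (t / 2)) * ennreal (unit_ball_vol DIM('a) * r powr DIM('a))"
      using le_maximal[OF r, of h] r by (simp add: emeasure_ball_powr distrib_right add_right_mono)
    finally show "(\<integral>\<^sup>+ y \<in> ball c r. g y \<partial>lebesgue)
      \<le> (maximal h x + ennreal (t / 2)) * ennreal (unit_ball_vol DIM('a) * r powr DIM('a))" .
  qed
  have "{x. ennreal t < maximal g x} \<subseteq> {x. ennreal (t / 2) < maximal h x}"
  proof safe
    fix x assume x: "ennreal t < maximal g x"
    show "ennreal (t / 2) < maximal h x"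
    proof (rule ccontr)
      assume "\<not> ennreal (t / 2) < maximal h x"
      then have "maximal h x + ennreal (t / 2) \<le> ennreal (t / 2) + ennreal (t / 2)"
        by (intro add_right_mono) simp
      also have "\<dots> = ennreal t"
        using t by (simp flip: ennreal_plus)
      finally show False
        using le[of x] x by auto
    qed
  qed
  moreover have "{x. ennreal (t / 2) < maximal h x} \<in> sets lebesgue"
    using borel_open[OF open_maximal_greater[of "ennreal (t / 2)" h]] by simp
  ultimately have "ennreal (t / 2) * emeasure lebesgue {x. ennreal t < maximal g x}
    \<le> ennreal (t / 2) * emeasure lebesgue {x. ennreal (t / 2) < maximal h x}"
    by (intro mult_left_mono emeasure_mono) auto
  also have "\<dots> \<le> ennreal (5 powr DIM('a)) * (\<integral>\<^sup>+ y. h y \<partial>lebesgue)"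
    using t by (intro maximal_weak_type) auto
  finally show ?thesis by (simp add: h_def)
qed

text \<open>A discrete layer-cake bound in which one term suffices: for finite x > \<tau>, the last
  level \<tau> 2^j strictly below x satisfies x \<le> \<tau> 2^(j+1), so the term with k = j is
  already at least x^p.\<close>

lemma ennpow_le_dyadic_sum:
  assumes p: "0 < p" and \<tau>: "0 < \<tau>"
  shows "ennpow x p \<le> ennreal (\<tau> powr p)
    + (\<Sum>k. ennreal ((\<tau> * 2 ^ Suc k) powr p) * indicator {ennreal (\<tau> * 2 ^ k)<..} x)"
    (is "_ \<le> _ + (\<Sum>k. ?a k)")
proof -
  have level: "ennreal ((\<tau> * 2 ^ Suc k) powr p) \<le> ennreal (\<tau> powr p) + (\<Sum>k. ?a k)"
    if "ennreal (\<tau> * 2 ^ k) < x" for k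
  proof -
    have "ennreal ((\<tau> * 2 ^ Suc k) powr p) = (\<Sum>j\<in>{k}. ?a j)"
      using that by simp
    also have "\<dots> \<le> (\<Sum>k. ?a k)"
      by (intro sum_le_suminf summableI) auto
    finally show ?thesis by (simp add: add_increasing)
  qed
  show ?thesis
  proof (cases x)
    case top
    \<comment> \<open>An infinite x activates every level, and the single terms are unbounded in
      k.\<close>
    have "ennreal (\<tau> powr p) + (\<Sum>k. ?a k) = top"
    proof (rule ccontr)
      assume "ennreal (\<tau> powr p) + (\<Sum>k. ?a k) \<noteq> top"
      then obtain B where B: "0 \<le> B" "ennreal (\<tau> powr p) + (\<Sum>k. ?a k) = ennreal B"
        by (cases "ennreal (\<tau> powr p) + (\<Sum>k. ?a k)") auto
      obtain k where k: "(B + 1) powr (1 / p) / \<tau> < 2 ^ k"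
        using real_arch_pow[of 2 "(B + 1) powr (1 / p) / \<tau>"] by auto
      have "(B + 1) powr (1 / p) \<le> \<tau> * 2 ^ k"
        using k \<tau> by (simp add: pos_divide_less_eq mult.commute)
      also have "\<dots> \<le> \<tau> * 2 ^ Suc k"
        using \<tau> by simp
      finally have k': "(B + 1) powr (1 / p) \<le> \<tau> * 2 ^ Suc k" .
      have "ennreal ((\<tau> * 2 ^ Suc k) powr p) \<le> ennreal B"
        unfolding B(2)[symmetric] by (rule level) (simp add: top)
      then have le: "(\<tau> * 2 ^ Suc k) powr p \<le> B"
        using B(1) by simp
      have "B + 1 = ((B + 1) powr (1 / p)) powr p"
        using B p by (simp add: powr_powr)
      also have "\<dots> \<le> (\<tau> * 2 ^ Suc k) powr p"
        using k' p by (intro powr_mono2) auto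
      finally show False using le by simp
    qed
    then show ?thesis by simp
  next
    case (real r)
    show ?thesis
    proof (cases "r \<le> \<tau>")
      case True
      then have "ennpow x p \<le> ennreal (\<tau> powr p)"
        using real p by (auto simp: ennpow_ennreal_nonneg intro!: ennreal_leI powr_mono2)
      then show ?thesis by (rule order_trans) simp
    next
      case False
      obtain m where "r / \<tau> < 2 ^ m"
        using real_arch_pow[of 2 "r / \<tau>"] by auto
      then have ex: "r \<le> \<tau> * 2 ^ m"
        using \<tau> by (simp add: field_simps)
      define k where "k = (LEAST k. r \<le> \<tau> * 2 ^ k)"
      have k: "r \<le> \<tau> * 2 ^ k"
        unfolding k_def by (rule LeastI[of _ m]) (fact ex)
      have "k \<noteq> 0"
        using k False by (intro notI) simp
      then obtain j where j: "k = Suc j" using not0_implies_Suc by blast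
      have "\<not> r \<le> \<tau> * 2 ^ j"
        using not_less_Least[of j "\<lambda>k. r \<le> \<tau> * 2 ^ k"] j by (simp add: k_def)
      then have "ennreal (\<tau> * 2 ^ j) < x"
        using real \<tau> by (simp add: ennreal_less_iff)
      note level[OF this]
      moreover have "ennpow x p \<le> ennreal ((\<tau> * 2 ^ Suc j) powr p)"
        using k j p real by (simp only: ennpow_ennreal_nonneg) (intro ennreal_leI powr_mono2, auto)
      ultimately show ?thesis by (rule order_trans[rotated])
    qed
  qed
qed

text \<open>The terms grow with ratio c = 2^q > 1, so the sum is at most c / (c - 1) times its last
  active term. An active level lies below 2 r, which accounts for the other factor 2^q.\<close>

lemma dyadic_sum_le_powr:
  fixes \<tau> q r :: real
  assumes "0 < q" "0 < \<tau>" "0 \<le> r"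
  shows "(\<Sum>k<N. (\<tau> * 2 ^ k) powr q * indicator {\<tau> * 2 ^ k / 2<..} r)
    \<le> 2 powr q * (2 powr q / (2 powr q - 1)) * r powr q"
proof -
  define c where "c = 2 powr q"
  have c: "1 < c" using assms by (simp add: c_def)
  have step: "(\<tau> * 2 ^ Suc N) powr q = c * (\<tau> * 2 ^ N) powr q" for N
    using assms by (simp add: powr_mult c_def)
  have geo: "(\<Sum>k<N. (\<tau> * 2 ^ k) powr q) \<le> (\<tau> * 2 ^ N) powr q / (c - 1)" for N
  proof (induction N)
    case 0
    then show ?case using c by simp
  next
    case (Suc N)
    have "(\<Sum>k<Suc N. (\<tau> * 2 ^ k) powr q) \<le> (\<tau> * 2 ^ N) powr q / (c - 1) + (\<tau> * 2 ^ N) powr q"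
      using Suc by simp
    also have "\<dots> = (\<tau> * 2 ^ Suc N) powr q / (c - 1)"
      unfolding step using c by (simp add: field_simps)
    finally show ?case .
  qed
  have "(\<Sum>k<N. (\<tau> * 2 ^ k) powr q * indicator {\<tau> * 2 ^ k / 2<..} r) \<le> c * (c / (c - 1)) * r powr q"
  proof (induction N)
    case 0
    then show ?case using c by simp
  next
    case (Suc N)
    show ?case
    proof (cases "\<tau> * 2 ^ N / 2 < r")
      case False
      then show ?thesis using Suc by simp
    next
      case True
      have "(\<Sum>k<Suc N. (\<tau> * 2 ^ k) powr q * indicator {\<tau> * 2 ^ k / 2<..} r) \<le> (\<Sum>k<Suc N. (\<tau> * 2 ^ k) powr q)"
        by (intro sum_mono) (auto split: split_indicator)
      also have "\<dots> \<le> (c / (c - 1)) * (\<tau> * 2 ^ N) powr q"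
        using geo[of "Suc N"] unfolding step by simp
      also have "\<dots> \<le> (c / (c - 1)) * (2 * r) powr q"
        using True assms c by (intro mult_left_mono powr_mono2) auto
      also have "\<dots> = c * (c / (c - 1)) * r powr q"
        using assms by (simp add: powr_mult c_def)
      finally show ?thesis .
    qed
  qed
  then show ?thesis by (simp add: c_def)
qed

text \<open>What remains pointwise once the sum over levels is moved under the integral: the levels
  active at x lie below 2 x, and their sum is of order x^(p - 1). The geometric growth comes from p
  > 1 and is what separates the strong from the weak type case.\<close>

lemma dyadic_sum_le_ennpow:
  assumes p: "1 < p" and \<tau>: "0 < \<tau>"
  defines "c \<equiv> 2 powr (p - 1)"
  shows "x * (\<Sum>k. ennreal ((\<tau> * 2 ^ k) powr (p - 1)) * indicator {ennreal (\<tau> * 2 ^ k / 2)<..} x)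
    \<le> ennreal (c * (c / (c - 1))) * ennpow x p"
proof (cases x)
  case top
  have "1 < c" using p by (simp add: c_def)
  then show ?thesis using p by (simp add: top ennpow_top ennreal_mult_top)
next
  case (real r)
  have "(\<Sum>k. ennreal ((\<tau> * 2 ^ k) powr (p - 1)) * indicator {ennreal (\<tau> * 2 ^ k / 2)<..} x)
    \<le> ennreal (c * (c / (c - 1)) * r powr (p - 1))"
  proof (intro suminf_le_const summableI)
    fix N
    have "(\<Sum>k<N. ennreal ((\<tau> * 2 ^ k) powr (p - 1)) * indicator {ennreal (\<tau> * 2 ^ k / 2)<..} x)
      = ennreal (\<Sum>k<N. (\<tau> * 2 ^ k) powr (p - 1) * indicator {\<tau> * 2 ^ k / 2<..} r)"
      using \<tau> real by (subst sum_ennreal[symmetric])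
        (auto simp: ennreal_less_iff split: split_indicator intro!: sum.cong)
    also have "\<dots> \<le> ennreal (c * (c / (c - 1)) * r powr (p - 1))"
      unfolding c_def using p \<tau> real by (intro ennreal_leI dyadic_sum_le_powr) auto
    finally show "(\<Sum>k<N. ennreal ((\<tau> * 2 ^ k) powr (p - 1)) * indicator {ennreal (\<tau> * 2 ^ k / 2)<..} x)
      \<le> ennreal (c * (c / (c - 1)) * r powr (p - 1))" .
  qed
  then have "x * (\<Sum>k. ennreal ((\<tau> * 2 ^ k) powr (p - 1)) * indicator {ennreal (\<tau> * 2 ^ k / 2)<..} x)
    \<le> ennreal r * ennreal (c * (c / (c - 1)) * r powr (p - 1))"
    unfolding real by (intro mult_left_mono) auto
  also have "\<dots> = ennreal (r * (c * (c / (c - 1)) * r powr (p - 1)))"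
    using real by (intro ennreal_mult'[symmetric])
  also have "r * (c * (c / (c - 1)) * r powr (p - 1)) = c * (c / (c - 1)) * r powr p"
    using real by (cases "r = 0") (auto simp: powr_diff)
  also have "ennreal (c * (c / (c - 1)) * r powr p) = ennreal (c * (c / (c - 1))) * ennreal (r powr p)"
    by (rule ennreal_mult'') simp
  also have "ennreal (r powr p) = ennpow x p"
    using real p by (simp only: ennpow_ennreal_nonneg)
  finally show ?thesis .
qed

section \<open>Localised unweighted maximal estimates\<close>

text \<open>
  The form in which the unweighted maximal theorem is used: on \<open>S\<close>, only balls inside \<open>S'\<close> matter up to
  the additive error \<open>T\<^bsup>1/p\<^esup>\<close>. Taking for \<open>\<phi>\<close> a power, or \<open>t\<close> times the indicator of \<open>{t<..}\<close>, treats
  the strong and the weak type estimate at once.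
\<close>

definition local_maximal_bound ::
  "'a::euclidean_space itself \<Rightarrow> real \<Rightarrow> real \<Rightarrow> (ennreal \<Rightarrow> ennreal) \<Rightarrow> bool" where
  "local_maximal_bound _ p C \<phi> \<longleftrightarrow> \<phi> \<in> borel_measurable borel \<and>
    (\<forall>(g :: 'a \<Rightarrow> ennreal) S S' T V.
      g \<in> borel_measurable lebesgue \<longrightarrow> S \<in> sets lebesgue \<longrightarrow> S' \<in> sets lebesgue \<longrightarrow>
      0 < T \<longrightarrow> 0 < V \<longrightarrow> emeasure lebesgue S \<le> ennreal V \<longrightarrow>
      (\<integral>\<^sup>+ y \<in> S'. ennpow (g y) p \<partial>lebesgue) \<le> ennreal (T * V) \<longrightarrow>
      (\<forall>y\<in>S. maximal g y \<le> max (maximal (\<lambda>z. g z * indicator S' z) y) (ennreal (T powr (1 / p)))) \<longrightarrow>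
      (\<integral>\<^sup>+ y \<in> S. \<phi> (maximal g y) \<partial>lebesgue) \<le> ennreal (C * T * V))"

text \<open>For t < T the trivial bound t |S| \<le> T V suffices. For t \<ge> T the error term T
  cannot lift the maximal function above t, so only g on S' counts and the weak type inequality
  applies. The constant adds up the two cases.\<close>

lemma local_maximal_bound_weak:
  assumes t: "0 < t"
  shows "local_maximal_bound TYPE('a::euclidean_space) 1 (1 + 5 powr DIM('a))
    (\<lambda>x. ennreal t * indicator {ennreal t<..} x)"
  unfolding local_maximal_bound_def
proof (intro conjI allI impI)
  fix g :: "'a \<Rightarrow> ennreal" and S S' :: "'a set" and T V :: real
  assume meas [measurable]: "g \<in> borel_measurable lebesgue" "S \<in> sets lebesgue" "S' \<in> sets lebesgue"
    and TV: "0 < T" "0 < V" and SV: "emeasure lebesgue S \<le> ennreal V"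
    and I: "(\<integral>\<^sup>+ y \<in> S'. ennpow (g y) 1 \<partial>lebesgue) \<le> ennreal (T * V)"
    and M: "\<forall>y\<in>S. maximal g y \<le> max (maximal (\<lambda>z. g z * indicator S' z) y) (ennreal (T powr (1 / 1)))"
  define h where "h z = g z * indicator S' z" for z
  have [measurable]: "h \<in> borel_measurable lebesgue" unfolding h_def by measurable
  have "{x. ennreal t < maximal h x} \<in> sets lebesgue"
    using borel_open[OF open_maximal_greater[of "ennreal t" h]] by simp
  note [measurable] = this
  show "(\<integral>\<^sup>+ y \<in> S. (ennreal t * indicator {ennreal t<..} (maximal g y)) \<partial>lebesgue)
    \<le> ennreal ((1 + 5 powr DIM('a)) * T * V)"
  proof (cases "t < T")
    case True
    have "(\<integral>\<^sup>+ y \<in> S. (ennreal t * indicator {ennreal t<..} (maximal g y)) \<partial>lebesgue)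
      \<le> (\<integral>\<^sup>+ y. ennreal T * indicator S y \<partial>lebesgue)"
      using True by (intro nn_integral_mono) (auto intro!: ennreal_leI split: split_indicator)
    also have "\<dots> = ennreal T * emeasure lebesgue S"
      by (simp add: nn_integral_cmult)
    also have "\<dots> \<le> ennreal T * ennreal V"
      using SV by (intro mult_left_mono) auto
    also have "\<dots> = ennreal (T * V)"
      using TV by (simp add: ennreal_mult)
    also have "\<dots> \<le> ennreal ((1 + 5 powr DIM('a)) * T * V)"
      using TV by (intro ennreal_leI) (simp add: algebra_simps)
    finally show ?thesis .
  next
    case False
    have "(\<integral>\<^sup>+ y \<in> S. (ennreal t * indicator {ennreal t<..} (maximal g y)) \<partial>lebesgue)
      \<le> (\<integral>\<^sup>+ y. ennreal t * indicator {x. ennreal t < maximal h x} y \<partial>lebesgue)"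
    proof (intro nn_integral_mono)
      fix y
      have "ennreal t < maximal h y" if "y \<in> S" "ennreal t < maximal g y"
      proof -
        have "maximal g y \<le> max (maximal h y) (ennreal T)"
          using M that TV by (simp add: h_def[abs_def])
        moreover have "ennreal T \<le> ennreal t"
          using False by (intro ennreal_leI) simp
        ultimately show ?thesis
          using that(2) by (auto simp: max_def split: if_splits)
      qed
      then show "ennreal t * indicator {ennreal t<..} (maximal g y) * indicator S y
        \<le> ennreal t * indicator {x. ennreal t < maximal h x} y"
        by (auto split: split_indicator)
    qed
    also have "\<dots> = ennreal t * emeasure lebesgue {x. ennreal t < maximal h x}"
      by (simp add: nn_integral_cmult)
    also have "\<dots> \<le> ennreal (5 powr DIM('a)) * (\<integral>\<^sup>+ y. h y \<partial>lebesgue)"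
      using t by (intro maximal_weak_type) auto
    also have "\<dots> \<le> ennreal (5 powr DIM('a)) * ennreal (T * V)"
      using I by (intro mult_left_mono) (auto simp: ennpow_one h_def)
    also have "\<dots> = ennreal (5 powr DIM('a) * (T * V))"
      using TV by (simp add: ennreal_mult)
    also have "\<dots> \<le> ennreal ((1 + 5 powr DIM('a)) * T * V)"
      using TV by (intro ennreal_leI) (simp add: algebra_simps)
    finally show ?thesis .
  qed
qed measurable

text \<open>Marcinkiewicz interpolation with dyadic levels that start at \<tau> = T^(1/p). Below
  \<tau> the trivial bound T |S| is available; above it only the maximal function of g on S' can be
  responsible. The truncated weak type bound measures each level set, and summing under the integral
  restores g^p.\<close>

lemma local_maximal_bound_strong:
  assumes p: "1 < p"
  shows "\<exists>C>0. local_maximal_bound TYPE('a::euclidean_space) p C (\<lambda>x. ennpow x p)"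
proof -
  define n :: real where "n = DIM('a)"
  define c where "c = 2 powr (p - 1)"
  have c: "1 < c" using p by (simp add: c_def)
  \<comment> \<open>5^n comes from the covering argument, 2 from the factor t/2 in the truncated
    weak type bound, and 2^p from replacing level 2^k by 2^(k+1).\<close>
  define B where "B = 5 powr n * 2 * 2 powr p"
  have B: "0 < B" by (simp add: B_def)
  define D where "D = c * (c / (c - 1))"
  have D: "0 < D" using c by (simp add: D_def)
  have "local_maximal_bound TYPE('a) p (1 + B * D) (\<lambda>x. ennpow x p)"
    unfolding local_maximal_bound_def
  proof (intro conjI allI impI)
    fix g :: "'a \<Rightarrow> ennreal" and S S' :: "'a set" and T V :: real
    assume meas [measurable]: "g \<in> borel_measurable lebesgue" "S \<in> sets lebesgue" "S' \<in> sets lebesgue"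
      and TV: "0 < T" "0 < V" and SV: "emeasure lebesgue S \<le> ennreal V"
      and I: "(\<integral>\<^sup>+ y \<in> S'. ennpow (g y) p \<partial>lebesgue) \<le> ennreal (T * V)"
      and M: "\<forall>y\<in>S. maximal g y \<le> max (maximal (\<lambda>z. g z * indicator S' z) y) (ennreal (T powr (1 / p)))"
    define h where "h z = g z * indicator S' z" for z
    have [measurable]: "h \<in> borel_measurable lebesgue" unfolding h_def by measurable
    define \<tau> where "\<tau> = T powr (1 / p)"
    have \<tau>: "0 < \<tau>" using TV by (simp add: \<tau>_def)
    have \<tau>p: "\<tau> powr p = T" using TV p by (simp add: \<tau>_def powr_powr)
    have lev [measurable]: "{x. ennreal u < maximal h x} \<in> sets lebesgue" for u
      using borel_open[OF open_maximal_greater[of "ennreal u" h]] by simp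
    define E where "E k = {x. ennreal (\<tau> * 2 ^ k) < maximal h x}" for k :: nat
    have [measurable]: "E k \<in> sets lebesgue" for k
      unfolding E_def by (rule lev)
    have "(\<integral>\<^sup>+ y \<in> S. ennpow (maximal g y) p \<partial>lebesgue)
      \<le> (\<integral>\<^sup>+ y. ennreal T * indicator S y
           + (\<Sum>k. ennreal ((\<tau> * 2 ^ Suc k) powr p) * indicator (E k) y) \<partial>lebesgue)"
    proof (intro nn_integral_mono)
      fix y
      show "ennpow (maximal g y) p * indicator S y
        \<le> ennreal T * indicator S y + (\<Sum>k. ennreal ((\<tau> * 2 ^ Suc k) powr p) * indicator (E k) y)"
      proof (cases "y \<in> S")
        case True
        have le: "maximal g y \<le> max (maximal h y) (ennreal \<tau>)"
          using M True by (simp add: h_def[abs_def] \<tau>_def)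
        \<comment> \<open>All levels are at least \<tau>, so the error term in \<open>M\<close>
          never exceeds them.\<close>
        have ind: "indicator {ennreal (\<tau> * 2 ^ k)<..} (maximal g y) \<le> (indicator (E k) y :: ennreal)" for k
        proof (cases "ennreal (\<tau> * 2 ^ k) < maximal g y")
          case True
          have "ennreal \<tau> \<le> ennreal (\<tau> * 2 ^ k)"
            using \<tau> by (intro ennreal_leI) simp
          with True le have "ennreal (\<tau> * 2 ^ k) < maximal h y"
            by (auto simp: max_def split: if_splits)
          then show ?thesis by (simp add: E_def indicator_def)
        qed simp
        have "ennpow (maximal g y) p \<le> ennreal T
          + (\<Sum>k. ennreal ((\<tau> * 2 ^ Suc k) powr p) * indicator {ennreal (\<tau> * 2 ^ k)<..} (maximal g y))"
          using ennpow_le_dyadic_sum[of p \<tau> "maximal g y"] p \<tau> by (simp add: \<tau>p)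
        also have "\<dots> \<le> ennreal T + (\<Sum>k. ennreal ((\<tau> * 2 ^ Suc k) powr p) * indicator (E k) y)"
          by (intro add_left_mono suminf_le summableI mult_left_mono ind) auto
        finally show ?thesis using True by simp
      qed simp
    qed
    also have "\<dots> = ennreal T * emeasure lebesgue S
        + (\<Sum>k. ennreal ((\<tau> * 2 ^ Suc k) powr p) * emeasure lebesgue (E k))"
      by (simp add: nn_integral_add nn_integral_cmult nn_integral_suminf)
    also have "\<dots> \<le> ennreal T * ennreal V + ennreal (B * D) * ennreal (T * V)"
    proof (intro add_mono mult_left_mono SV)
      have "(\<Sum>k. ennreal ((\<tau> * 2 ^ Suc k) powr p) * emeasure lebesgue (E k))
        \<le> (\<Sum>k. \<integral>\<^sup>+ y. ennreal B * (h y * (ennreal ((\<tau> * 2 ^ k) powr (p - 1))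
              * indicator {ennreal (\<tau> * 2 ^ k / 2)<..} (h y))) \<partial>lebesgue)"
      proof (intro suminf_le summableI)
        fix k
        define t where "t = \<tau> * 2 ^ k"
        have t: "0 < t" using \<tau> by (simp add: t_def)
        have "(\<tau> * 2 ^ Suc k) powr p = 2 powr p * (t powr (p - 1) * t)"
          using \<tau> t by (simp add: t_def powr_mult powr_diff)
        then have "ennreal ((\<tau> * 2 ^ Suc k) powr p)
          = ennreal (2 * 2 powr p * t powr (p - 1)) * ennreal (t / 2)"
          using t by (simp flip: ennreal_mult'')
        then have "ennreal ((\<tau> * 2 ^ Suc k) powr p) * emeasure lebesgue (E k)
          = ennreal (2 * 2 powr p * t powr (p - 1)) * (ennreal (t / 2) * emeasure lebesgue (E k))"
          by (simp add: mult.assoc)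
        also have "\<dots> \<le> ennreal (2 * 2 powr p * t powr (p - 1)) * (ennreal (5 powr n)
          * (\<integral>\<^sup>+ y. h y * indicator {ennreal (t / 2)<..} (h y) \<partial>lebesgue))"
          unfolding E_def n_def using t maximal_weak_type_truncated[of h t]
          by (intro mult_left_mono) (auto simp: t_def)
        also have "\<dots> = ennreal (B * t powr (p - 1))
          * (\<integral>\<^sup>+ y. h y * indicator {ennreal (t / 2)<..} (h y) \<partial>lebesgue)"
          by (simp add: B_def ennreal_mult mult_ac)
        also have "\<dots> = (\<integral>\<^sup>+ y. ennreal (B * t powr (p - 1))
          * (h y * indicator {ennreal (t / 2)<..} (h y)) \<partial>lebesgue)"
          by (rule nn_integral_cmult[symmetric]) measurable
        also have "\<dots> = (\<integral>\<^sup>+ y. ennreal B * (h y * (ennreal (t powr (p - 1))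
              * indicator {ennreal (t / 2)<..} (h y))) \<partial>lebesgue)"
          using B by (intro nn_integral_cong) (simp add: ennreal_mult mult_ac)
        finally show "ennreal ((\<tau> * 2 ^ Suc k) powr p) * emeasure lebesgue (E k)
          \<le> (\<integral>\<^sup>+ y. ennreal B * (h y * (ennreal ((\<tau> * 2 ^ k) powr (p - 1))
              * indicator {ennreal (\<tau> * 2 ^ k / 2)<..} (h y))) \<partial>lebesgue)"
          by (simp add: t_def)
      qed
      also have "\<dots> = (\<integral>\<^sup>+ y. (\<Sum>k. ennreal B * (h y * (ennreal ((\<tau> * 2 ^ k) powr (p - 1))
              * indicator {ennreal (\<tau> * 2 ^ k / 2)<..} (h y)))) \<partial>lebesgue)"
        by (rule nn_integral_suminf[symmetric]) measurable
      also have "\<dots> \<le> (\<integral>\<^sup>+ y. ennreal B * (ennreal D * ennpow (h y) p) \<partial>lebesgue)"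
        unfolding ennreal_suminf_cmult D_def c_def
        by (intro nn_integral_mono mult_left_mono dyadic_sum_le_ennpow p \<tau>) auto
      also have "\<dots> = ennreal (B * D) * (\<integral>\<^sup>+ y. ennpow (h y) p \<partial>lebesgue)"
        using B D by (simp add: nn_integral_cmult ennreal_mult mult.assoc)
      also have "(\<integral>\<^sup>+ y. ennpow (h y) p \<partial>lebesgue) = (\<integral>\<^sup>+ y \<in> S'. ennpow (g y) p \<partial>lebesgue)"
        using p by (intro nn_integral_cong) (auto simp: h_def ennpow_def split: split_indicator)
      also have "ennreal (B * D) * (\<integral>\<^sup>+ y \<in> S'. ennpow (g y) p \<partial>lebesgue) \<le> ennreal (B * D) * ennreal (T * V)"
        by (intro mult_left_mono I) auto
      finally show "(\<Sum>k. ennreal ((\<tau> * 2 ^ Suc k) powr p) * emeasure lebesgue (E k))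
        \<le> ennreal (B * D) * ennreal (T * V)" .
    qed auto
    also have "\<dots> = ennreal ((1 + B * D) * T * V)"
      using TV B D by (simp add: distrib_right mult.assoc flip: ennreal_mult ennreal_plus)
    finally show "(\<integral>\<^sup>+ y \<in> S. ennpow (maximal g y) p \<partial>lebesgue) \<le> ennreal ((1 + B * D) * T * V)" .
  qed measurable
  then show ?thesis
    using B D by (intro exI[of _ "1 + B * D"]) (auto intro: add_pos_pos)
qed

section \<open>Power weights on balls\<close>

text \<open>The sign of q decides which of the two comparisons is used, hence |q| in the constant.
  Factors such as \<open>2 powr \<bar>\<beta>\<bar>\<close> below originate here.\<close>

lemma powr_le_of_comparable:
  fixes u v q \<kappa> :: real
  assumes "0 < u" "1 \<le> \<kappa>" "u \<le> \<kappa> * v" "v \<le> \<kappa> * u"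
  shows "v powr q \<le> \<kappa> powr \<bar>q\<bar> * u powr q"
proof (cases "0 \<le> q")
  case True
  have "0 < \<kappa> * v" using assms by linarith
  then have "0 < v" using assms by (simp add: zero_less_mult_iff)
  then have "v powr q \<le> (\<kappa> * u) powr q"
    using True assms by (intro powr_mono2) auto
  then show ?thesis using True assms by (simp add: powr_mult)
next
  case False
  have "v powr q \<le> (u / \<kappa>) powr q"
    using False assms by (intro powr_mono2') (auto simp: field_simps)
  also have "\<dots> = \<kappa> powr \<bar>q\<bar> * u powr q"
    using False assms by (simp add: powr_divide powr_minus field_simps)
  finally show ?thesis .
qed

lemma set_nn_integral_subset_le:
  fixes f :: "'a \<Rightarrow> ennreal"
  shows "A \<subseteq> B \<Longrightarrow> (\<integral>\<^sup>+ x \<in> A. f x \<partial>M) \<le> (\<integral>\<^sup>+ x \<in> B. f x \<partial>M)"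
  by (intro nn_integral_mono) (auto split: split_indicator)

lemma weight_measurable_lebesgue [measurable]:
  "(\<lambda>y::'a::euclidean_space. ennreal (norm y powr \<beta>)) \<in> borel_measurable lebesgue"
  by (intro measurable_completion) simp

text \<open>Freezing the weight at u^\<beta>. With its converse below, this is how weighted
  estimates are traded for unweighted ones away from the origin.\<close>

lemma set_nn_integral_mult_weight_le:
  fixes h :: "'a::euclidean_space \<Rightarrow> ennreal"
  assumes [measurable]: "h \<in> borel_measurable lebesgue" "S \<in> sets lebesgue"
    and u: "0 < u" "1 \<le> \<kappa>" "\<And>y. y \<in> S \<Longrightarrow> u \<le> \<kappa> * norm y \<and> norm y \<le> \<kappa> * u"
    and I: "(\<integral>\<^sup>+ y \<in> S. h y \<partial>lebesgue) \<le> ennreal B"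
  shows "(\<integral>\<^sup>+ y \<in> S. (h y * ennreal (norm y powr \<beta>)) \<partial>lebesgue) \<le> ennreal (\<kappa> powr \<bar>\<beta>\<bar> * u powr \<beta> * B)"
proof -
  have "(\<integral>\<^sup>+ y \<in> S. (h y * ennreal (norm y powr \<beta>)) \<partial>lebesgue)
    \<le> (\<integral>\<^sup>+ y. ennreal (\<kappa> powr \<bar>\<beta>\<bar> * u powr \<beta>) * (h y * indicator S y) \<partial>lebesgue)"
  proof (intro nn_integral_mono)
    fix y
    have "norm y powr \<beta> \<le> \<kappa> powr \<bar>\<beta>\<bar> * u powr \<beta>" if "y \<in> S"
      using u(3)[OF that] u by (intro powr_le_of_comparable) auto
    then have "h y * ennreal (norm y powr \<beta>) \<le> h y * ennreal (\<kappa> powr \<bar>\<beta>\<bar> * u powr \<beta>)" if "y \<in> S"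
      using that by (intro mult_left_mono ennreal_leI) auto
    then show "h y * ennreal (norm y powr \<beta>) * indicator S y
      \<le> ennreal (\<kappa> powr \<bar>\<beta>\<bar> * u powr \<beta>) * (h y * indicator S y)"
      by (auto simp: mult.commute split: split_indicator)
  qed
  also have "\<dots> = ennreal (\<kappa> powr \<bar>\<beta>\<bar> * u powr \<beta>) * (\<integral>\<^sup>+ y \<in> S. h y \<partial>lebesgue)"
    by (rule nn_integral_cmult) measurable
  also have "\<dots> \<le> ennreal (\<kappa> powr \<bar>\<beta>\<bar> * u powr \<beta>) * ennreal B"
    using I by (intro mult_left_mono) auto
  also have "\<dots> = ennreal (\<kappa> powr \<bar>\<beta>\<bar> * u powr \<beta> * B)"
    by (rule ennreal_mult'[symmetric]) simp
  finally show ?thesis .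
qed

text \<open>The previous lemma for the inverse weight, again a power weight. Comparability with u >
  0 keeps S off the origin, where the two weights would not cancel.\<close>

lemma set_nn_integral_le_mult_weight:
  fixes h :: "'a::euclidean_space \<Rightarrow> ennreal"
  assumes [measurable]: "h \<in> borel_measurable lebesgue" "S \<in> sets lebesgue"
    and u: "0 < u" "1 \<le> \<kappa>" "\<And>y. y \<in> S \<Longrightarrow> u \<le> \<kappa> * norm y \<and> norm y \<le> \<kappa> * u"
    and I: "(\<integral>\<^sup>+ y \<in> S. (h y * ennreal (norm y powr \<beta>)) \<partial>lebesgue) \<le> ennreal B"
  shows "(\<integral>\<^sup>+ y \<in> S. h y \<partial>lebesgue) \<le> ennreal (\<kappa> powr \<bar>\<beta>\<bar> * u powr - \<beta> * B)"
proof -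
  have "(\<integral>\<^sup>+ y \<in> S. h y \<partial>lebesgue) = (\<integral>\<^sup>+ y \<in> S. (h y * ennreal (norm y powr \<beta>) * ennreal (norm y powr - \<beta>)) \<partial>lebesgue)"
  proof (intro nn_integral_cong)
    fix y
    have "ennreal (norm y powr \<beta>) * ennreal (norm y powr - \<beta>) = 1" if "y \<in> S"
    proof -
      have "0 < \<kappa> * norm y" using u(1) u(3)[OF that] by linarith
      then have "y \<noteq> 0" by auto
      then show ?thesis by (simp flip: ennreal_mult powr_add)
    qed
    then show "h y * indicator S y
      = h y * ennreal (norm y powr \<beta>) * ennreal (norm y powr - \<beta>) * indicator S y"
      by (auto simp: mult.assoc split: split_indicator)
  qed
  also have "\<dots> \<le> ennreal (\<kappa> powr \<bar>- \<beta>\<bar> * u powr - \<beta> * B)"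
    using u I by (intro set_nn_integral_mult_weight_le) auto
  finally show ?thesis by simp
qed

section \<open>The weight of a ball is comparable to r^n (|x| + r)^\<sigma>\<close>

text \<open>A ball of radius r/4, pushed radially outward by r/2, stays inside B(x, r), and on it
  |y| lies between (|x| + r)/4 and |x| + r. Hence every real \<sigma> is allowed, including those
  not integrable at the origin.\<close>

lemma weight_ball_lower:
  fixes \<sigma> :: real
  shows "\<exists>c>0. \<forall>(x::'a::euclidean_space) r. 0 < r \<longrightarrow>
    ennreal (c * (r powr DIM('a) * (norm x + r) powr \<sigma>)) \<le> (\<integral>\<^sup>+ y \<in> ball x r. ennreal (norm y powr \<sigma>) \<partial>lebesgue)"
proof -
  define n :: real where "n = DIM('a)"
  define \<omega> where "\<omega> = unit_ball_vol n"
  have \<omega>: "0 < \<omega>" by (simp add: \<omega>_def n_def)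
  define c where "c = 4 powr - \<bar>\<sigma>\<bar> * \<omega> * 4 powr - n"
  have "ennreal (c * (r powr n * (norm x + r) powr \<sigma>)) \<le> (\<integral>\<^sup>+ y \<in> ball x r. ennreal (norm y powr \<sigma>) \<partial>lebesgue)"
    if r: "0 < r" for x :: 'a and r
  proof -
    \<comment> \<open>The outward direction at x; at the origin any unit vector will do.\<close>
    obtain u :: 'a where u: "norm u = 1" "x = norm x *\<^sub>R u"
    proof (cases "x = 0")
      case True
      then show ?thesis using that vector_choose_size[of 1] by auto
    next
      case False
      then show ?thesis by (intro that[of "x /\<^sub>R norm x"]) auto
    qed
    define z where "z = x + (r / 2) *\<^sub>R u"
    have "z = (norm x + r / 2) *\<^sub>R u"
      using u by (simp add: z_def scaleR_add_left)
    then have nz: "norm z = norm x + r / 2"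
      using u r by simp
    have dz: "dist x z = r / 2"
      using u r by (simp add: z_def dist_norm)
    have sub: "ball z (r / 4) \<subseteq> ball x r"
    proof
      fix y assume "y \<in> ball z (r / 4)"
      then show "y \<in> ball x r"
        using dz r dist_triangle[of x y z] by simp
    qed
    have low: "4 powr - \<bar>\<sigma>\<bar> * (norm x + r) powr \<sigma> \<le> norm y powr \<sigma>" if "y \<in> ball z (r / 4)" for y
    proof -
      have "norm (y - z) < r / 4" using that by (simp add: dist_norm norm_minus_commute)
      then have "norm y \<le> norm x + r" "norm x + r / 4 \<le> norm y"
        using nz norm_triangle_ineq2[of y z] norm_triangle_ineq2[of z y] by (auto simp: norm_minus_commute)
      then have "0 < norm y \<and> norm x + r \<le> 4 * norm y \<and> norm y \<le> 4 * (norm x + r)"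
        using r norm_ge_zero[of x] by argo
      then have "(norm x + r) powr \<sigma> \<le> 4 powr \<bar>\<sigma>\<bar> * norm y powr \<sigma>"
        by (intro powr_le_of_comparable) auto
      then show ?thesis by (simp add: powr_minus field_simps)
    qed
    have "ennreal (c * (r powr n * (norm x + r) powr \<sigma>))
      = ennreal (4 powr - \<bar>\<sigma>\<bar> * (norm x + r) powr \<sigma>) * emeasure lebesgue (ball z (r / 4))"
      using r \<omega> by (simp add: emeasure_ball_powr c_def \<omega>_def n_def powr_divide powr_minus field_simps flip: ennreal_mult)
    also have "\<dots> = (\<integral>\<^sup>+ y \<in> ball z (r / 4). ennreal (4 powr - \<bar>\<sigma>\<bar> * (norm x + r) powr \<sigma>) \<partial>lebesgue)"
      by (rule nn_integral_cmult_indicator[symmetric]) simp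
    also have "\<dots> \<le> (\<integral>\<^sup>+ y \<in> ball x r. ennreal (norm y powr \<sigma>) \<partial>lebesgue)"
      using low sub by (intro nn_integral_mono) (auto split: split_indicator intro!: ennreal_leI)
    finally show ?thesis .
  qed
  moreover have "0 < c" using \<omega> by (simp add: c_def)
  ultimately show ?thesis unfolding n_def by blast
qed

text \<open>If 2 r \<le> |x|, the weight varies on the ball by a bounded factor. Otherwise the ball
  lies in B(0, 3 r), whose weight is a geometric series over shells with exponent n + \<sigma> > 0,
  and 3 r is comparable to |x| + r.\<close>

lemma weight_ball_upper:
  fixes \<sigma> :: real
  assumes \<sigma>: "- real DIM('a::euclidean_space) < \<sigma>"
  shows "\<exists>C>0. \<forall>(x::'a) r. 0 < r \<longrightarrow>
    (\<integral>\<^sup>+ y \<in> ball x r. ennreal (norm y powr \<sigma>) \<partial>lebesgue) \<le> ennreal (C * (r powr DIM('a) * (norm x + r) powr \<sigma>))"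
proof -
  define n :: real where "n = DIM('a)"
  have n\<sigma>: "0 < n + \<sigma>" using \<sigma> by (simp add: n_def)
  define \<omega> where "\<omega> = unit_ball_vol n"
  have \<omega>: "0 < \<omega>" by (simp add: \<omega>_def n_def)
  define q where "q = 1 - 2 powr - (n + \<sigma>)"
  have q: "0 < q" using n\<sigma> by (simp add: q_def powr_less_one)
  define C1 where "C1 = 2 powr \<bar>\<sigma>\<bar> * \<omega> / q * (3 powr n * 3 powr \<bar>\<sigma>\<bar>)"
  define C2 where "C2 = 3 powr \<bar>\<sigma>\<bar> * \<omega>"
  have C: "0 < C1" "0 < C2" using q \<omega> by (auto simp: C1_def C2_def)
  have "(\<integral>\<^sup>+ y \<in> ball x r. ennreal (norm y powr \<sigma>) \<partial>lebesgue) \<le> ennreal ((C1 + C2) * (r powr n * (norm x + r) powr \<sigma>))"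
    if r: "0 < r" for x :: 'a and r
  proof (cases "2 * r \<le> norm x")
    case True
    have "(\<integral>\<^sup>+ y \<in> ball x r. (1 * ennreal (norm y powr \<sigma>)) \<partial>lebesgue)
      \<le> ennreal (3 powr \<bar>\<sigma>\<bar> * (norm x + r) powr \<sigma> * (\<omega> * r powr n))"
    proof (intro set_nn_integral_mult_weight_le conjI)
      fix y assume "y \<in> ball x r"
      then have "norm (y - x) < r" by (simp add: dist_norm norm_minus_commute)
      then show "norm x + r \<le> 3 * norm y" "norm y \<le> 3 * (norm x + r)"
        using True norm_triangle_ineq2[of y x] norm_triangle_ineq2[of x y] by (auto simp: norm_minus_commute)
    qed (use r \<omega> in \<open>auto simp: emeasure_ball_powr \<omega>_def n_def intro!: add_nonneg_pos\<close>)
    also have "\<dots> = ennreal (C2 * (r powr n * (norm x + r) powr \<sigma>))"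
      by (simp add: C2_def mult_ac)
    also have "\<dots> \<le> ennreal ((C1 + C2) * (r powr n * (norm x + r) powr \<sigma>))"
      using C by (intro ennreal_leI mult_right_mono) auto
    finally show ?thesis by simp
  next
    case False
    have "(\<integral>\<^sup>+ y \<in> ball x r. ennreal (norm y powr \<sigma>) \<partial>lebesgue)
      \<le> (\<integral>\<^sup>+ y \<in> ball (0::'a) (3 * r). ennreal (norm y powr \<sigma>) \<partial>lebesgue)"
    proof (intro set_nn_integral_subset_le subsetI)
      fix y assume "y \<in> ball x r"
      then show "y \<in> ball 0 (3 * r)"
        using False norm_triangle_ineq2[of y x] by (simp add: dist_norm norm_minus_commute)
    qed
    also have "\<dots> \<le> ennreal (2 powr \<bar>\<sigma>\<bar> * \<omega> / (1 - 2 powr - (n + \<sigma>)) * (3 * r) powr (n + \<sigma>))"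
    proof (intro set_nn_integral_ball_le_of_shells n\<sigma>)
      fix s :: real assume s: "0 < s"
      have "(\<integral>\<^sup>+ y \<in> shell s. (1 * ennreal (norm (y::'a) powr \<sigma>)) \<partial>lebesgue)
        \<le> ennreal (2 powr \<bar>\<sigma>\<bar> * s powr \<sigma> * (\<omega> * s powr n))"
        using s emeasure_shell_le[OF s, where 'a = 'a]
        by (intro set_nn_integral_mult_weight_le) (auto simp: shell_def \<omega>_def n_def)
      then show "(\<integral>\<^sup>+ y \<in> shell s. ennreal (norm (y::'a) powr \<sigma>) \<partial>lebesgue) \<le> ennreal (2 powr \<bar>\<sigma>\<bar> * \<omega> * s powr (n + \<sigma>))"
        by (simp add: powr_add mult_ac)
    qed (use r \<omega> weight_measurable_lebesgue in auto)
    also have "\<dots> \<le> ennreal (C1 * (r powr n * (norm x + r) powr \<sigma>))"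
    proof (intro ennreal_leI)
      have "0 < norm x + r \<and> norm x + r \<le> 3 * (3 * r) \<and> 3 * r \<le> 3 * (norm x + r)"
        using r False norm_ge_zero[of x] by argo
      then have "(3 * r) powr \<sigma> \<le> 3 powr \<bar>\<sigma>\<bar> * (norm x + r) powr \<sigma>"
        by (intro powr_le_of_comparable) auto
      then have "2 powr \<bar>\<sigma>\<bar> * \<omega> / q * (3 powr n * r powr n) * (3 * r) powr \<sigma>
        \<le> 2 powr \<bar>\<sigma>\<bar> * \<omega> / q * (3 powr n * r powr n) * (3 powr \<bar>\<sigma>\<bar> * (norm x + r) powr \<sigma>)"
        using q \<omega> by (intro mult_left_mono) auto
      then show "2 powr \<bar>\<sigma>\<bar> * \<omega> / (1 - 2 powr - (n + \<sigma>)) * (3 * r) powr (n + \<sigma>)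
        \<le> C1 * (r powr n * (norm x + r) powr \<sigma>)"
        unfolding q_def[symmetric] C1_def using r by (simp add: powr_add powr_mult mult_ac)
    qed
    also have "\<dots> \<le> ennreal ((C1 + C2) * (r powr n * (norm x + r) powr \<sigma>))"
      using C by (intro ennreal_leI mult_right_mono) auto
    finally show ?thesis .
  qed
  moreover have "0 < C1 + C2" using C by simp
  ultimately show ?thesis unfolding n_def by blast
qed

section \<open>Maximal functions of Morrey functions\<close>

text \<open>\<open>A\<close> stands for the p-th power of the Morrey norm up to a constant, with the
  denominator replaced by its explicit model. As a family of real bounds it involves neither
  quotients nor roots.\<close>

definition morrey_bounded ::
  "real \<Rightarrow> real \<Rightarrow> real \<Rightarrow> real \<Rightarrow> ('a::euclidean_space \<Rightarrow> ennreal) \<Rightarrow> real \<Rightarrow> bool" where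
  "morrey_bounded p a b \<beta> g A \<longleftrightarrow> (\<forall>x r. 0 < r \<longrightarrow>
    (\<integral>\<^sup>+ y \<in> ball x r. (ennpow (g y) p * ennreal (norm y powr \<beta>)) \<partial>lebesgue)
      \<le> ennreal (A * (r powr a * (norm x + r) powr b)))"

locale morrey_exponents =
  fixes dim :: "'a::euclidean_space itself" and p a b \<beta> n e \<omega> :: real
  assumes n_def: "n = real DIM('a)"
    and \<omega>_def: "\<omega> = unit_ball_vol n"
    and e_def: "e = a + b - \<beta> - n"
    and p_ge: "1 \<le> p" and ab_pos: "0 < a + b" and a_less: "a < n"
    and e_le: "e \<le> 0" and e_gr: "0 < e + n * p"
begin

lemma \<omega>_pos: "0 < \<omega>"
  by (simp add: \<omega>_def n_def)

lemma set_nn_integral_power_le: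
  fixes g :: "'a \<Rightarrow> ennreal"
  assumes [measurable]: "g \<in> borel_measurable lebesgue" "S \<in> sets lebesgue"
    and g: "morrey_bounded p a b \<beta> g A" and "0 < r" "S \<subseteq> ball x r"
    and "0 < u" "1 \<le> \<kappa>" "\<And>y. y \<in> S \<Longrightarrow> u \<le> \<kappa> * norm y \<and> norm y \<le> \<kappa> * u"
  shows "(\<integral>\<^sup>+ y \<in> S. ennpow (g y) p \<partial>lebesgue)
    \<le> ennreal (\<kappa> powr \<bar>\<beta>\<bar> * u powr - \<beta> * (A * (r powr a * (norm x + r) powr b)))"
proof (rule set_nn_integral_le_mult_weight)
  have "(\<integral>\<^sup>+ y \<in> S. (ennpow (g y) p * ennreal (norm y powr \<beta>)) \<partial>lebesgue)
    \<le> (\<integral>\<^sup>+ y \<in> ball x r. (ennpow (g y) p * ennreal (norm y powr \<beta>)) \<partial>lebesgue)"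
    by (intro set_nn_integral_subset_le) fact
  also have "\<dots> \<le> ennreal (A * (r powr a * (norm x + r) powr b))"
    using g \<open>0 < r\<close> by (auto simp: morrey_bounded_def)
  finally show "(\<integral>\<^sup>+ y \<in> S. (ennpow (g y) p * ennreal (norm y powr \<beta>)) \<partial>lebesgue)
    \<le> ennreal (A * (r powr a * (norm x + r) powr b))" .
qed (use assms in auto)

text \<open>On the shell of size s, freezing the weight gives g^p a mean of order A s^e; truncation
  turns this into an integral of g of order A^(1/p) s^(n + e/p). As n + e/p > 0, the shells sum to a
  multiple of the largest one.\<close>

lemma centred_ball_integral_le:
  "\<exists>C>0. \<forall>(g :: 'a \<Rightarrow> ennreal) A R. g \<in> borel_measurable lebesgue \<longrightarrow> morrey_bounded p a b \<beta> g A \<longrightarrow>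
    0 < A \<longrightarrow> 0 < R \<longrightarrow>
    (\<integral>\<^sup>+ y \<in> ball 0 R. g y \<partial>lebesgue) \<le> ennreal (C * A powr (1 / p) * R powr (n + e / p))"
proof -
  have \<delta>: "0 < n + e / p"
    using e_gr p_ge by (simp add: field_simps)
  \<comment> \<open>2^|\<beta>| is the cost of freezing the weight on a shell; \<omega> normalises
    by the volume bound \<omega> s^n of the shell.\<close>
  define D where "D = 2 powr \<bar>\<beta>\<bar> / \<omega>"
  have D: "0 < D" using \<omega>_pos by (simp add: D_def)
  define q where "q = 1 - 2 powr - (n + e / p)"
  have q: "0 < q" using \<delta> by (simp add: q_def powr_less_one)
  define C where "C = 2 * D powr (1 / p) * \<omega> / q"
  have C: "0 < C" using D q \<omega>_pos by (simp add: C_def)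
  have "(\<integral>\<^sup>+ y \<in> ball 0 R. g y \<partial>lebesgue) \<le> ennreal (C * A powr (1 / p) * R powr (n + e / p))"
    if g [measurable]: "g \<in> borel_measurable lebesgue" and mb: "morrey_bounded p a b \<beta> g A"
      and A: "0 < A" and R: "0 < R" for g :: "'a \<Rightarrow> ennreal" and A R
  proof -
    have "(\<integral>\<^sup>+ y \<in> ball 0 R. g y \<partial>lebesgue)
      \<le> ennreal (2 * D powr (1 / p) * \<omega> * A powr (1 / p) / (1 - 2 powr - (n + e / p)) * R powr (n + e / p))"
    proof (intro set_nn_integral_ball_le_of_shells g \<delta> R)
      fix s :: real assume s: "0 < s"
      have "(\<integral>\<^sup>+ y \<in> shell s. ennpow (g y) p \<partial>lebesgue)
        \<le> ennreal (2 powr \<bar>\<beta>\<bar> * s powr - \<beta> * (A * (s powr a * (norm (0::'a) + s) powr b)))"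
        using s by (intro set_nn_integral_power_le mb) (auto simp: shell_def)
      also have "2 powr \<bar>\<beta>\<bar> * s powr - \<beta> * (A * (s powr a * (norm (0::'a) + s) powr b))
        = D * A * s powr e * (\<omega> * s powr n)"
        using s \<omega>_pos by (simp add: D_def e_def powr_diff powr_add powr_minus field_simps)
      finally have "(\<integral>\<^sup>+ y \<in> shell s. g y \<partial>lebesgue)
        \<le> ennreal (2 * (D * A * s powr e) powr (1 / p) * (\<omega> * s powr n))"
        using s D A p_ge \<omega>_pos emeasure_shell_le[OF s, where 'a = 'a]
        by (intro set_nn_integral_le_of_power) (auto simp: \<omega>_def n_def)
      also have "2 * (D * A * s powr e) powr (1 / p) * (\<omega> * s powr n)
        = 2 * D powr (1 / p) * \<omega> * A powr (1 / p) * s powr (n + e / p)"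
        using D A by (simp add: powr_mult powr_powr powr_add)
      finally show "(\<integral>\<^sup>+ y \<in> shell s. g y \<partial>lebesgue)
        \<le> ennreal (2 * D powr (1 / p) * \<omega> * A powr (1 / p) * s powr (n + e / p))" .
    qed (use D A \<omega>_pos in auto)
    also have "2 * D powr (1 / p) * \<omega> * A powr (1 / p) / (1 - 2 powr - (n + e / p)) * R powr (n + e / p)
      = C * A powr (1 / p) * R powr (n + e / p)"
      unfolding C_def q_def by simp
    finally show ?thesis .
  qed
  with C show ?thesis by blast
qed

text \<open>The ball lies in B(0, 18 \<rho>), since |z| < |y| + 2 \<rho>. Because e \<le> 0,
  replacing \<rho> by the smaller |y|/16 can only increase \<rho>^(e/p), so a single pointwise bound
  serves all these radii. The 16 is what far balls require, where |y| \<le> 2 |x| and \<rho> \<ge>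
  |x|/8.\<close>

lemma wide_ball_integral_le:
  "\<exists>C>0. \<forall>(g :: 'a \<Rightarrow> ennreal) A y c \<rho>. g \<in> borel_measurable lebesgue \<longrightarrow> morrey_bounded p a b \<beta> g A \<longrightarrow>
    0 < A \<longrightarrow> y \<in> ball c \<rho> \<longrightarrow> 0 < norm y \<longrightarrow> norm y \<le> 16 * \<rho> \<longrightarrow>
    (\<integral>\<^sup>+ z \<in> ball c \<rho>. g z \<partial>lebesgue) \<le> ennreal (C * A powr (1 / p) * norm y powr (e / p) * (\<omega> * \<rho> powr n))"
proof -
  obtain C1 where C1: "0 < C1" "\<And>(g :: 'a \<Rightarrow> ennreal) A R. g \<in> borel_measurable lebesgue \<Longrightarrow>
    morrey_bounded p a b \<beta> g A \<Longrightarrow> 0 < A \<Longrightarrow> 0 < R \<Longrightarrow>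
    (\<integral>\<^sup>+ y \<in> ball 0 R. g y \<partial>lebesgue) \<le> ennreal (C1 * A powr (1 / p) * R powr (n + e / p))"
    using centred_ball_integral_le by blast
  define C where "C = C1 * 18 powr (n + e / p) * 16 powr - (e / p) / \<omega>"
  have C: "0 < C" using C1 \<omega>_pos by (simp add: C_def)
  have "(\<integral>\<^sup>+ z \<in> ball c \<rho>. g z \<partial>lebesgue) \<le> ennreal (C * A powr (1 / p) * norm y powr (e / p) * (\<omega> * \<rho> powr n))"
    if g: "g \<in> borel_measurable lebesgue" "morrey_bounded p a b \<beta> g A" "0 < A"
      and y: "y \<in> ball c \<rho>" "0 < norm y" "norm y \<le> 16 * \<rho>" for g :: "'a \<Rightarrow> ennreal" and A y c \<rho>
  proof -
    have \<rho>: "0 < \<rho>" using y by linarith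
    have sub: "ball c \<rho> \<subseteq> ball 0 (18 * \<rho>)"
    proof
      fix z assume "z \<in> ball c \<rho>"
      then have "dist y z < 2 * \<rho>"
        using y(1) dist_triangle[of y z c] by (simp add: dist_commute)
      then show "z \<in> ball 0 (18 * \<rho>)"
        using y dist_triangle[of 0 z y] by simp
    qed
    have "\<rho> powr (e / p) \<le> (norm y / 16) powr (e / p)"
      using y e_le p_ge by (intro powr_mono2') (auto simp: divide_nonpos_pos)
    also have "\<dots> = 16 powr - (e / p) * norm y powr (e / p)"
      using y by (simp add: powr_divide powr_minus field_simps)
    finally have le: "\<rho> powr (e / p) \<le> 16 powr - (e / p) * norm y powr (e / p)" .
    have "(\<integral>\<^sup>+ z \<in> ball c \<rho>. g z \<partial>lebesgue) \<le> (\<integral>\<^sup>+ z \<in> ball 0 (18 * \<rho>). g z \<partial>lebesgue)"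
      by (intro set_nn_integral_subset_le sub)
    also have "\<dots> \<le> ennreal (C1 * A powr (1 / p) * (18 * \<rho>) powr (n + e / p))"
      using g \<rho> by (intro C1) auto
    also have "\<dots> = ennreal (C1 * A powr (1 / p) * 18 powr (n + e / p) * \<rho> powr n * \<rho> powr (e / p))"
      using \<rho> by (simp add: powr_mult powr_add mult_ac)
    also have "\<dots> \<le> ennreal (C1 * A powr (1 / p) * 18 powr (n + e / p) * \<rho> powr n * (16 powr - (e / p) * norm y powr (e / p)))"
      using C1 by (intro ennreal_leI mult_left_mono le) auto
    also have "\<dots> = ennreal (C * A powr (1 / p) * norm y powr (e / p) * (\<omega> * \<rho> powr n))"
      using \<omega>_pos by (simp add: C_def mult_ac)
    finally show ?thesis .
  qed
  with C show ?thesis by blast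
qed

text \<open>The local estimate is used with T = D A s^e, the size of the means of g^p near the
  shell: balls of radius at least s/8 have averages at most T^(1/p), smaller ones stay in S'.
  Freezing the weight again, the exponents add up to \<beta> + e + n = a + b.\<close>

lemma maximal_bound_shell:
  assumes "0 < C0"
  shows "\<exists>C>0. \<forall>\<phi> (g :: 'a \<Rightarrow> ennreal) A s. local_maximal_bound TYPE('a) p C0 \<phi> \<longrightarrow>
    g \<in> borel_measurable lebesgue \<longrightarrow> morrey_bounded p a b \<beta> g A \<longrightarrow> 0 < A \<longrightarrow> 0 < s \<longrightarrow>
    (\<integral>\<^sup>+ y \<in> shell s. (\<phi> (maximal g y) * ennreal (norm y powr \<beta>)) \<partial>lebesgue) \<le> ennreal (C * A * s powr (a + b))"
proof -
  obtain C1 where C1: "0 < C1" "\<And>(g :: 'a \<Rightarrow> ennreal) A y c \<rho>. g \<in> borel_measurable lebesgue \<Longrightarrow>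
    morrey_bounded p a b \<beta> g A \<Longrightarrow> 0 < A \<Longrightarrow> y \<in> ball c \<rho> \<Longrightarrow> 0 < norm y \<Longrightarrow> norm y \<le> 16 * \<rho> \<Longrightarrow>
    (\<integral>\<^sup>+ z \<in> ball c \<rho>. g z \<partial>lebesgue) \<le> ennreal (C1 * A powr (1 / p) * norm y powr (e / p) * (\<omega> * \<rho> powr n))"
    using wide_ball_integral_le by blast
  \<comment> \<open>One constant for two duties: the first summand makes T^(1/p) dominate the
    averages over wide balls, the second makes T \<omega> s^n dominate the integral of g^p over
    S'.\<close>
  define D where "D = (C1 * 2 powr \<bar>e / p\<bar>) powr p + 4 powr \<bar>\<beta>\<bar> * 2 powr (a + b) / \<omega>"
  have D: "0 < D" using C1 \<omega>_pos by (simp add: D_def add_pos_pos)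
  have D1: "C1 * 2 powr \<bar>e / p\<bar> \<le> D powr (1 / p)"
  proof -
    have "C1 * 2 powr \<bar>e / p\<bar> = ((C1 * 2 powr \<bar>e / p\<bar>) powr p) powr (1 / p)"
      using C1 p_ge by (simp add: powr_powr)
    also have "\<dots> \<le> D powr (1 / p)"
      using p_ge \<omega>_pos by (intro powr_mono2) (auto simp: D_def)
    finally show ?thesis .
  qed
  have D2: "4 powr \<bar>\<beta>\<bar> * 2 powr (a + b) \<le> D * \<omega>"
    using \<omega>_pos by (simp add: D_def distrib_right)
  define C where "C = 2 powr \<bar>\<beta>\<bar> * C0 * D * \<omega>"
  have C: "0 < C" using assms D \<omega>_pos by (simp add: C_def)
  have "(\<integral>\<^sup>+ y \<in> shell s. (\<phi> (maximal g y) * ennreal (norm y powr \<beta>)) \<partial>lebesgue) \<le> ennreal (C * A * s powr (a + b))"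
    if \<phi>: "local_maximal_bound TYPE('a) p C0 \<phi>"
      and g [measurable]: "g \<in> borel_measurable lebesgue" and mb: "morrey_bounded p a b \<beta> g A"
      and A: "0 < A" and s: "0 < s" for \<phi> and g :: "'a \<Rightarrow> ennreal" and A s
  proof -
    have \<phi>_meas [measurable]: "\<phi> \<in> borel_measurable borel"
      using \<phi> by (simp add: local_maximal_bound_def)
    define S' :: "'a set" where "S' = {y. s / 4 \<le> norm y \<and> norm y < 2 * s}"
    have "S' \<in> sets borel" unfolding S'_def by measurable
    then have S' [measurable]: "S' \<in> sets lebesgue" by simp
    define T where "T = D * A * s powr e"
    have T: "0 < T" using D A s by (simp add: T_def)
    have Tp: "T powr (1 / p) = D powr (1 / p) * A powr (1 / p) * s powr (e / p)"
      using D A by (simp add: T_def powr_mult powr_powr)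
    have "(\<integral>\<^sup>+ y \<in> S'. ennpow (g y) p \<partial>lebesgue)
      \<le> ennreal (4 powr \<bar>\<beta>\<bar> * s powr - \<beta> * (A * ((2 * s) powr a * (norm (0::'a) + 2 * s) powr b)))"
      using s by (intro set_nn_integral_power_le mb) (auto simp: S'_def)
    also have "4 powr \<bar>\<beta>\<bar> * s powr - \<beta> * (A * ((2 * s) powr a * (norm (0::'a) + 2 * s) powr b))
      = (4 powr \<bar>\<beta>\<bar> * 2 powr (a + b)) * (A * (s powr e * s powr n))"
      using s by (simp add: e_def powr_mult powr_diff powr_add powr_minus field_simps)
    also have "ennreal \<dots> \<le> ennreal ((D * \<omega>) * (A * (s powr e * s powr n)))"
      using A by (intro ennreal_leI mult_right_mono D2) auto
    finally have IS': "(\<integral>\<^sup>+ y \<in> S'. ennpow (g y) p \<partial>lebesgue) \<le> ennreal (T * (\<omega> * s powr n))"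
      by (simp add: T_def mult_ac)
    have M: "maximal g y \<le> max (maximal (\<lambda>z. g z * indicator S' z) y) (ennreal (T powr (1 / p)))"
      if y: "y \<in> shell s" for y
    proof (rule maximal_leI)
      fix c :: 'a and \<rho> :: real assume \<rho>: "0 < \<rho>" "y \<in> ball c \<rho>"
      have yn: "s / 2 \<le> norm y" "norm y < s" using y by (auto simp: shell_def)
      show "(\<integral>\<^sup>+ z \<in> ball c \<rho>. g z \<partial>lebesgue)
        \<le> max (maximal (\<lambda>z. g z * indicator S' z) y) (ennreal (T powr (1 / p)))
          * ennreal (unit_ball_vol DIM('a) * \<rho> powr DIM('a))"
      \<comment> \<open>All points of such a ball are within 2 \<rho> < s/4 of y, hence have norm
        between s/4 and 5 s/4.\<close>
      proof (cases "\<rho> < s / 8")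
        case True
        have "ball c \<rho> \<subseteq> S'"
        proof
          fix z assume "z \<in> ball c \<rho>"
          then have "norm (z - y) < 2 * \<rho>"
            using \<rho> dist_triangle[of y z c] by (simp add: dist_commute flip: dist_norm)
          then show "z \<in> S'"
            using True yn norm_triangle_ineq2[of z y] norm_triangle_ineq2[of y z]
            by (auto simp: S'_def norm_minus_commute)
        qed
        then have "(\<integral>\<^sup>+ z \<in> ball c \<rho>. g z \<partial>lebesgue) = (\<integral>\<^sup>+ z \<in> ball c \<rho>. (g z * indicator S' z) \<partial>lebesgue)"
          by (intro nn_integral_cong) (auto split: split_indicator)
        also have "\<dots> \<le> maximal (\<lambda>z. g z * indicator S' z) y * ennreal (unit_ball_vol DIM('a) * \<rho> powr DIM('a))"
          by (rule le_maximal[OF \<rho>])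
        also have "\<dots> \<le> max (maximal (\<lambda>z. g z * indicator S' z) y) (ennreal (T powr (1 / p)))
          * ennreal (unit_ball_vol DIM('a) * \<rho> powr DIM('a))"
          by (intro mult_right_mono) auto
        finally show ?thesis .
      next
        case False
        have "norm y powr (e / p) \<le> 2 powr \<bar>e / p\<bar> * s powr (e / p)"
          using yn s by (intro powr_le_of_comparable) auto
        then have "C1 * A powr (1 / p) * norm y powr (e / p) \<le> C1 * A powr (1 / p) * (2 powr \<bar>e / p\<bar> * s powr (e / p))"
          using C1 by (intro mult_left_mono) auto
        also have "\<dots> = (C1 * 2 powr \<bar>e / p\<bar>) * (A powr (1 / p) * s powr (e / p))"
          by simp
        also have "\<dots> \<le> T powr (1 / p)"
          unfolding Tp mult.assoc[of "D powr (1 / p)"] by (intro mult_right_mono D1) auto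
        finally have le: "C1 * A powr (1 / p) * norm y powr (e / p) \<le> T powr (1 / p)" .
        have "(\<integral>\<^sup>+ z \<in> ball c \<rho>. g z \<partial>lebesgue) \<le> ennreal (C1 * A powr (1 / p) * norm y powr (e / p) * (\<omega> * \<rho> powr n))"
          using g mb A \<rho> False yn s by (intro C1) auto
        also have "\<dots> \<le> ennreal (T powr (1 / p) * (\<omega> * \<rho> powr n))"
          using \<omega>_pos by (intro ennreal_leI mult_right_mono le) auto
        also have "\<dots> = ennreal (T powr (1 / p)) * ennreal (unit_ball_vol DIM('a) * \<rho> powr DIM('a))"
          by (simp add: \<omega>_def n_def ennreal_mult')
        also have "\<dots> \<le> max (maximal (\<lambda>z. g z * indicator S' z) y) (ennreal (T powr (1 / p)))
          * ennreal (unit_ball_vol DIM('a) * \<rho> powr DIM('a))"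
          by (intro mult_right_mono) auto
        finally show ?thesis .
      qed
    qed
    have "(\<integral>\<^sup>+ y \<in> shell s. \<phi> (maximal g y) \<partial>lebesgue) \<le> ennreal (C0 * T * (\<omega> * s powr n))"
    proof -
      have "emeasure lebesgue (shell s :: 'a set) \<le> ennreal (\<omega> * s powr n)"
        using emeasure_shell_le[OF s, where 'a = 'a] by (simp add: \<omega>_def n_def)
      moreover have "0 < \<omega> * s powr n" using \<omega>_pos s by simp
      ultimately show ?thesis
        using \<phi>[unfolded local_maximal_bound_def, THEN conjunct2, rule_format, of g "shell s" S' T "\<omega> * s powr n"]
          g S' T IS' M by simp
    qed
    then have "(\<integral>\<^sup>+ y \<in> shell s. (\<phi> (maximal g y) * ennreal (norm y powr \<beta>)) \<partial>lebesgue)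
      \<le> ennreal (2 powr \<bar>\<beta>\<bar> * s powr \<beta> * (C0 * T * (\<omega> * s powr n)))"
      using s by (intro set_nn_integral_mult_weight_le) (auto simp: shell_def)
    also have "2 powr \<bar>\<beta>\<bar> * s powr \<beta> * (C0 * T * (\<omega> * s powr n)) = C * A * s powr (a + b)"
      using s by (simp add: C_def T_def e_def powr_diff powr_add field_simps)
    finally show ?thesis .
  qed
  with C show ?thesis by blast
qed

text \<open>The reference scale is now r: T has the order A r^(a - n) |x|^(b - \<beta>) of the means
  of g^p over B(x, 2 r). Between the local and the wide balls lies a third range, r/2 \<le> \<rho> <
  |x|/8, where the Morrey bound itself controls the averages. Since a < n, the factor r^(a - n)
  dominates \<rho>^(a - n) there, up to a constant, and |x|^(a - n) for the wide balls.\<close>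

lemma maximal_bound_far_ball:
  assumes "0 < C0"
  shows "\<exists>C>0. \<forall>\<phi> (g :: 'a \<Rightarrow> ennreal) A x r. local_maximal_bound TYPE('a) p C0 \<phi> \<longrightarrow>
    g \<in> borel_measurable lebesgue \<longrightarrow> morrey_bounded p a b \<beta> g A \<longrightarrow> 0 < A \<longrightarrow> 0 < r \<longrightarrow> 4 * r \<le> norm x \<longrightarrow>
    (\<integral>\<^sup>+ y \<in> ball x r. (\<phi> (maximal g y) * ennreal (norm y powr \<beta>)) \<partial>lebesgue)
      \<le> ennreal (C * A * (r powr a * norm x powr b))"
proof -
  obtain C1 where C1: "0 < C1" "\<And>(g :: 'a \<Rightarrow> ennreal) A y c \<rho>. g \<in> borel_measurable lebesgue \<Longrightarrow>
    morrey_bounded p a b \<beta> g A \<Longrightarrow> 0 < A \<Longrightarrow> y \<in> ball c \<rho> \<Longrightarrow> 0 < norm y \<Longrightarrow> norm y \<le> 16 * \<rho> \<Longrightarrow>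
    (\<integral>\<^sup>+ z \<in> ball c \<rho>. g z \<partial>lebesgue) \<le> ennreal (C1 * A powr (1 / p) * norm y powr (e / p) * (\<omega> * \<rho> powr n))"
    using wide_ball_integral_le by blast
  define E where "E = 2 powr \<bar>\<beta>\<bar> * 2 powr \<bar>b\<bar> / \<omega>"
  have E: "0 < E" using \<omega>_pos by (simp add: E_def)
  \<comment> \<open>4^a comes from enlarging the ball to B(x, 4 \<rho>), and 2^(n - a) from \<rho>
    \<ge> r/2.\<close>
  define F where "F = E * 4 powr a * 2 powr (n - a)"
  have F: "0 < F" using E by (simp add: F_def)
  \<comment> \<open>The summands serve, in order, the wide balls, the integral of g^p over S', and
    the middle range, where 2^p compensates the factor 2 lost by truncation.\<close>
  define D where "D = (C1 * 2 powr \<bar>e / p\<bar>) powr p + E * 2 powr a + 2 powr p * F"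
  have D: "0 < D" using C1 E F by (simp add: D_def add_pos_pos)
  have D1: "C1 * 2 powr \<bar>e / p\<bar> \<le> D powr (1 / p)"
  proof -
    have "C1 * 2 powr \<bar>e / p\<bar> = ((C1 * 2 powr \<bar>e / p\<bar>) powr p) powr (1 / p)"
      using C1 p_ge by (simp add: powr_powr)
    also have "\<dots> \<le> D powr (1 / p)"
      using p_ge E F by (intro powr_mono2) (auto simp: D_def)
    finally show ?thesis .
  qed
  have D2: "E * 2 powr a \<le> D"
    using F by (simp add: D_def)
  have D3: "2 * F powr (1 / p) \<le> D powr (1 / p)"
  proof -
    have "2 * F powr (1 / p) = (2 powr p * F) powr (1 / p)"
      using F p_ge by (simp add: powr_powr powr_mult)
    also have "\<dots> \<le> D powr (1 / p)"
      using p_ge E F by (intro powr_mono2) (auto simp: D_def)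
    finally show ?thesis .
  qed
  define C where "C = 2 powr \<bar>\<beta>\<bar> * C0 * D * \<omega>"
  have C: "0 < C" using assms D \<omega>_pos by (simp add: C_def)
  have "(\<integral>\<^sup>+ y \<in> ball x r. (\<phi> (maximal g y) * ennreal (norm y powr \<beta>)) \<partial>lebesgue)
      \<le> ennreal (C * A * (r powr a * norm x powr b))"
    if \<phi>: "local_maximal_bound TYPE('a) p C0 \<phi>"
      and g [measurable]: "g \<in> borel_measurable lebesgue" and mb: "morrey_bounded p a b \<beta> g A"
      and A: "0 < A" and r: "0 < r" and rx: "4 * r \<le> norm x" for \<phi> and g :: "'a \<Rightarrow> ennreal" and A x r
  proof -
    have \<phi>_meas [measurable]: "\<phi> \<in> borel_measurable borel"
      using \<phi> by (simp add: local_maximal_bound_def)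
    have x: "0 < norm x" using r rx by linarith
    have near: "norm x \<le> 2 * norm z \<and> norm z \<le> 2 * norm x" if "z \<in> ball x \<sigma>" "2 * \<sigma> \<le> norm x" for z \<sigma>
    proof -
      have "norm (z - x) < \<sigma>" using that by (simp add: dist_norm norm_minus_commute)
      then show ?thesis
        using that norm_triangle_ineq2[of z x] norm_triangle_ineq2[of x z] by (auto simp: norm_minus_commute)
    qed
    \<comment> \<open>As long as B(x, \<sigma>) keeps away from the origin, both the weight and (|x|
      + \<sigma>)^b can be frozen at |x|, which leaves an unweighted Morrey bound.\<close>
    have pow: "(\<integral>\<^sup>+ y \<in> ball x \<sigma>. ennpow (g y) p \<partial>lebesgue)
      \<le> ennreal (E * (A * (\<sigma> powr a * norm x powr (b - \<beta>))) * \<omega>)"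
      if \<sigma>: "0 < \<sigma>" "2 * \<sigma> \<le> norm x" for \<sigma>
    proof -
      have "(\<integral>\<^sup>+ y \<in> ball x \<sigma>. ennpow (g y) p \<partial>lebesgue)
        \<le> ennreal (2 powr \<bar>\<beta>\<bar> * norm x powr - \<beta> * (A * (\<sigma> powr a * (norm x + \<sigma>) powr b)))"
        using \<sigma> x near[of _ \<sigma>] by (intro set_nn_integral_power_le mb) auto
      also have "\<dots> \<le> ennreal (2 powr \<bar>\<beta>\<bar> * norm x powr - \<beta> * (A * (\<sigma> powr a * (2 powr \<bar>b\<bar> * norm x powr b))))"
        using \<sigma> x A by (intro ennreal_leI mult_left_mono powr_le_of_comparable) auto
      also have "2 powr \<bar>\<beta>\<bar> * norm x powr - \<beta> * (A * (\<sigma> powr a * (2 powr \<bar>b\<bar> * norm x powr b)))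
        = E * (A * (\<sigma> powr a * norm x powr (b - \<beta>))) * \<omega>"
        using \<omega>_pos x by (simp add: E_def powr_diff powr_minus field_simps)
      finally show ?thesis .
    qed
    define U where "U = A * (r powr (a - n) * norm x powr (b - \<beta>))"
    have U: "0 < U" using A r x by (simp add: U_def)
    define T where "T = D * U"
    have T: "0 < T" using D U by (simp add: T_def)
    have Tp: "T powr (1 / p) = D powr (1 / p) * U powr (1 / p)"
      using D U by (simp add: T_def powr_mult)
    define S' where "S' = ball x (2 * r)"
    have S' [measurable]: "S' \<in> sets lebesgue" by (simp add: S'_def)
    have "(\<integral>\<^sup>+ y \<in> S'. ennpow (g y) p \<partial>lebesgue) \<le> ennreal (E * (A * ((2 * r) powr a * norm x powr (b - \<beta>))) * \<omega>)"
      unfolding S'_def using r rx by (intro pow) auto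
    also have "E * (A * ((2 * r) powr a * norm x powr (b - \<beta>))) * \<omega> = (E * 2 powr a) * (U * (\<omega> * r powr n))"
      using r by (simp add: U_def powr_mult powr_diff)
    also have "ennreal \<dots> \<le> ennreal (D * (U * (\<omega> * r powr n)))"
      using U \<omega>_pos by (intro ennreal_leI mult_right_mono D2) auto
    finally have IS': "(\<integral>\<^sup>+ y \<in> S'. ennpow (g y) p \<partial>lebesgue) \<le> ennreal (T * (\<omega> * r powr n))"
      by (simp add: T_def mult_ac)
    have M: "maximal g y \<le> max (maximal (\<lambda>z. g z * indicator S' z) y) (ennreal (T powr (1 / p)))"
      if y: "y \<in> ball x r" for y
    proof (rule maximal_leI)
      fix c :: 'a and \<rho> :: real assume \<rho>: "0 < \<rho>" "y \<in> ball c \<rho>"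
      have sub: "ball c \<rho> \<subseteq> ball x (r + 2 * \<rho>)"
      proof
        fix z assume z: "z \<in> ball c \<rho>"
        have "dist x z \<le> dist x y + (dist y c + dist c z)"
          using dist_triangle[of x z y] dist_triangle[of y z c] by linarith
        then show "z \<in> ball x (r + 2 * \<rho>)"
          using z \<rho>(2) y by (simp add: dist_commute)
      qed
      have scale: "(\<integral>\<^sup>+ z \<in> ball c \<rho>. g z \<partial>lebesgue)
          \<le> max (maximal (\<lambda>z. g z * indicator S' z) y) (ennreal (T powr (1 / p)))
            * ennreal (unit_ball_vol DIM('a) * \<rho> powr DIM('a))"
        if le: "(\<integral>\<^sup>+ z \<in> ball c \<rho>. g z \<partial>lebesgue) \<le> ennreal (Z * (\<omega> * \<rho> powr n))"
        and Z: "Z \<le> T powr (1 / p)" for Z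
      proof -
        note le
        also have "ennreal (Z * (\<omega> * \<rho> powr n)) \<le> ennreal (T powr (1 / p) * (\<omega> * \<rho> powr n))"
          using \<omega>_pos by (intro ennreal_leI mult_right_mono Z) auto
        also have "\<dots> = ennreal (T powr (1 / p)) * ennreal (unit_ball_vol DIM('a) * \<rho> powr DIM('a))"
          by (simp add: \<omega>_def n_def ennreal_mult')
        also have "\<dots> \<le> max (maximal (\<lambda>z. g z * indicator S' z) y) (ennreal (T powr (1 / p)))
          * ennreal (unit_ball_vol DIM('a) * \<rho> powr DIM('a))"
          by (intro mult_right_mono) auto
        finally show ?thesis .
      qed
      \<comment> \<open>The first threshold keeps the ball inside B(x, 2 r), the second lets
        \<open>pow\<close> apply to B(x, 4 \<rho>), and beyond it |y| \<le> 2 |x| \<le> 16 \<rho>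
        makes the ball wide.\<close>
      consider "\<rho> < r / 2" | "r / 2 \<le> \<rho>" "\<rho> < norm x / 8" | "norm x / 8 \<le> \<rho>" by linarith
      then show "(\<integral>\<^sup>+ z \<in> ball c \<rho>. g z \<partial>lebesgue)
        \<le> max (maximal (\<lambda>z. g z * indicator S' z) y) (ennreal (T powr (1 / p)))
          * ennreal (unit_ball_vol DIM('a) * \<rho> powr DIM('a))"
      proof cases
        case 1
        then have "ball c \<rho> \<subseteq> S'"
          unfolding S'_def by (intro order_trans[OF sub] subset_ball) simp
        then have "(\<integral>\<^sup>+ z \<in> ball c \<rho>. g z \<partial>lebesgue) = (\<integral>\<^sup>+ z \<in> ball c \<rho>. (g z * indicator S' z) \<partial>lebesgue)"
          by (intro nn_integral_cong) (auto split: split_indicator)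
        also have "\<dots> \<le> maximal (\<lambda>z. g z * indicator S' z) y * ennreal (unit_ball_vol DIM('a) * \<rho> powr DIM('a))"
          by (rule le_maximal[OF \<rho>])
        also have "\<dots> \<le> max (maximal (\<lambda>z. g z * indicator S' z) y) (ennreal (T powr (1 / p)))
          * ennreal (unit_ball_vol DIM('a) * \<rho> powr DIM('a))"
          by (intro mult_right_mono) auto
        finally show ?thesis .
      next
        case 2
        have "ball c \<rho> \<subseteq> ball x (4 * \<rho>)"
          using sub 2(1) by (intro order_trans[OF sub] subset_ball) simp
        then have "(\<integral>\<^sup>+ z \<in> ball c \<rho>. ennpow (g z) p \<partial>lebesgue) \<le> (\<integral>\<^sup>+ z \<in> ball x (4 * \<rho>). ennpow (g z) p \<partial>lebesgue)"
          by (rule set_nn_integral_subset_le)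
        also have "\<dots> \<le> ennreal (E * (A * ((4 * \<rho>) powr a * norm x powr (b - \<beta>))) * \<omega>)"
          using 2 \<rho> by (intro pow) auto
        also have "\<dots> = ennreal (E * 4 powr a * A * norm x powr (b - \<beta>) * \<rho> powr (a - n) * (\<omega> * \<rho> powr n))"
          using \<rho> by (simp add: powr_mult powr_diff[of \<rho>] mult_ac)
        also have "\<dots> \<le> ennreal (E * 4 powr a * A * norm x powr (b - \<beta>) * (2 powr (n - a) * r powr (a - n)) * (\<omega> * \<rho> powr n))"
        proof (intro ennreal_leI mult_right_mono mult_left_mono)
          have "\<rho> powr (a - n) \<le> (r / 2) powr (a - n)"
            using 2 r a_less by (intro powr_mono2') auto
          also have "\<dots> = 2 powr (n - a) * r powr (a - n)"
            using r by (simp add: powr_divide powr_diff field_simps)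
          finally show "\<rho> powr (a - n) \<le> 2 powr (n - a) * r powr (a - n)" .
        qed (use E A \<omega>_pos in auto)
        also have "\<dots> = ennreal ((F * U) * (\<omega> * \<rho> powr n))"
          by (simp add: F_def U_def mult_ac)
        finally have "(\<integral>\<^sup>+ z \<in> ball c \<rho>. g z \<partial>lebesgue) \<le> ennreal (2 * (F * U) powr (1 / p) * (\<omega> * \<rho> powr n))"
          using F U \<omega>_pos \<rho> p_ge by (intro set_nn_integral_le_of_power) (auto simp: emeasure_ball_powr \<omega>_def n_def)
        moreover have "2 * (F * U) powr (1 / p) \<le> T powr (1 / p)"
          using mult_right_mono[OF D3, of "U powr (1 / p)"] F U by (simp add: Tp powr_mult mult.assoc)
        ultimately show ?thesis by (rule scale)
      next
        case 3
        have yx: "norm x \<le> 2 * norm y \<and> norm y \<le> 2 * norm x"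
          using y r rx by (intro near[of y r]) auto
        have "norm y powr (e / p) \<le> 2 powr \<bar>e / p\<bar> * norm x powr (e / p)"
          using yx x by (intro powr_le_of_comparable) auto
        then have "C1 * A powr (1 / p) * norm y powr (e / p) \<le> C1 * A powr (1 / p) * (2 powr \<bar>e / p\<bar> * norm x powr (e / p))"
          using C1 by (intro mult_left_mono) auto
        also have "\<dots> = (C1 * 2 powr \<bar>e / p\<bar>) * (A * norm x powr e) powr (1 / p)"
          using A by (simp add: powr_mult powr_powr)
        also have "\<dots> \<le> D powr (1 / p) * (A * norm x powr e) powr (1 / p)"
          by (intro mult_right_mono D1) auto
        also have "\<dots> \<le> D powr (1 / p) * U powr (1 / p)"
        proof (intro mult_left_mono powr_mono2)
          \<comment> \<open>The exponent splits as e = (a - n) + (b - \<beta>); since a < n,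
            lowering |x| to r raises the first factor.\<close>
          have "norm x powr e = norm x powr (a - n) * norm x powr (b - \<beta>)"
            using x by (simp add: e_def algebra_simps flip: powr_add)
          also have "\<dots> \<le> r powr (a - n) * norm x powr (b - \<beta>)"
            using a_less r rx by (intro mult_right_mono powr_mono2') auto
          finally show "A * norm x powr e \<le> U"
            unfolding U_def using A by (intro mult_left_mono) auto
        qed (use A p_ge in auto)
        finally have "C1 * A powr (1 / p) * norm y powr (e / p) \<le> T powr (1 / p)"
          unfolding Tp .
        moreover have "(\<integral>\<^sup>+ z \<in> ball c \<rho>. g z \<partial>lebesgue) \<le> ennreal (C1 * A powr (1 / p) * norm y powr (e / p) * (\<omega> * \<rho> powr n))"
          using g mb A \<rho> 3 yx x by (intro C1) auto
        ultimately show ?thesis by (rule scale[rotated])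
      qed
    qed
    have "(\<integral>\<^sup>+ y \<in> ball x r. \<phi> (maximal g y) \<partial>lebesgue) \<le> ennreal (C0 * T * (\<omega> * r powr n))"
    proof -
      have "emeasure lebesgue (ball x r) \<le> ennreal (\<omega> * r powr n)"
        using r by (simp add: emeasure_ball_powr \<omega>_def n_def)
      moreover have "0 < \<omega> * r powr n" using \<omega>_pos r by simp
      ultimately show ?thesis
        using \<phi>[unfolded local_maximal_bound_def, THEN conjunct2, rule_format, of g "ball x r" S' T "\<omega> * r powr n"]
          g S' T IS' M by simp
    qed
    then have "(\<integral>\<^sup>+ y \<in> ball x r. (\<phi> (maximal g y) * ennreal (norm y powr \<beta>)) \<partial>lebesgue)
      \<le> ennreal (2 powr \<bar>\<beta>\<bar> * norm x powr \<beta> * (C0 * T * (\<omega> * r powr n)))"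
      using x r rx near[of _ r] by (intro set_nn_integral_mult_weight_le) auto
    also have "2 powr \<bar>\<beta>\<bar> * norm x powr \<beta> * (C0 * T * (\<omega> * r powr n)) = C * A * (r powr a * norm x powr b)"
      using r x by (simp add: C_def T_def U_def powr_diff field_simps)
    finally show ?thesis .
  qed
  with C show ?thesis by blast
qed

text \<open>Balls that are not far satisfy |x| < 4 r and lie in B(0, 5 r), where the shell bounds of
  order s^(a + b) sum geometrically and r is comparable to |x| + r. The constant is fixed before
  \<phi>, so it is uniform over families of \<phi> such as the level indicators of the weak type
  case.\<close>

lemma maximal_bound:
  assumes "0 < C0"
  shows "\<exists>C>0. \<forall>\<phi> (g :: 'a \<Rightarrow> ennreal) A x r. local_maximal_bound TYPE('a) p C0 \<phi> \<longrightarrow>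
    g \<in> borel_measurable lebesgue \<longrightarrow> morrey_bounded p a b \<beta> g A \<longrightarrow> 0 < A \<longrightarrow> 0 < r \<longrightarrow>
    (\<integral>\<^sup>+ y \<in> ball x r. (\<phi> (maximal g y) * ennreal (norm y powr \<beta>)) \<partial>lebesgue)
      \<le> ennreal (C * A * (r powr a * (norm x + r) powr b))"
proof -
  obtain C1 where C1: "0 < C1" "\<And>\<phi> (g :: 'a \<Rightarrow> ennreal) A x r. local_maximal_bound TYPE('a) p C0 \<phi> \<Longrightarrow>
    g \<in> borel_measurable lebesgue \<Longrightarrow> morrey_bounded p a b \<beta> g A \<Longrightarrow> 0 < A \<Longrightarrow> 0 < r \<Longrightarrow> 4 * r \<le> norm x \<Longrightarrow>
    (\<integral>\<^sup>+ y \<in> ball x r. (\<phi> (maximal g y) * ennreal (norm y powr \<beta>)) \<partial>lebesgue)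
      \<le> ennreal (C1 * A * (r powr a * norm x powr b))"
    using maximal_bound_far_ball[OF assms] by blast
  obtain C2 where C2: "0 < C2" "\<And>\<phi> (g :: 'a \<Rightarrow> ennreal) A s. local_maximal_bound TYPE('a) p C0 \<phi> \<Longrightarrow>
    g \<in> borel_measurable lebesgue \<Longrightarrow> morrey_bounded p a b \<beta> g A \<Longrightarrow> 0 < A \<Longrightarrow> 0 < s \<Longrightarrow>
    (\<integral>\<^sup>+ y \<in> shell s. (\<phi> (maximal g y) * ennreal (norm y powr \<beta>)) \<partial>lebesgue) \<le> ennreal (C2 * A * s powr (a + b))"
    using maximal_bound_shell[OF assms] by blast
  define q where "q = 1 - 2 powr - (a + b)"
  have q: "0 < q" using ab_pos by (simp add: q_def powr_less_one)
  define K where "K = C2 / q * 5 powr (a + b) * 5 powr \<bar>b\<bar>"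
  have K: "0 < K" using C2 q by (simp add: K_def)
  define C where "C = C1 * 2 powr \<bar>b\<bar> + K"
  have "(\<integral>\<^sup>+ y \<in> ball x r. (\<phi> (maximal g y) * ennreal (norm y powr \<beta>)) \<partial>lebesgue)
      \<le> ennreal (C * A * (r powr a * (norm x + r) powr b))"
    if \<phi>: "local_maximal_bound TYPE('a) p C0 \<phi>"
      and g [measurable]: "g \<in> borel_measurable lebesgue" and mb: "morrey_bounded p a b \<beta> g A"
      and A: "0 < A" and r: "0 < r" for \<phi> and g :: "'a \<Rightarrow> ennreal" and A x r
  proof (cases "4 * r \<le> norm x")
    case True
    have "(\<integral>\<^sup>+ y \<in> ball x r. (\<phi> (maximal g y) * ennreal (norm y powr \<beta>)) \<partial>lebesgue)
      \<le> ennreal (C1 * A * (r powr a * norm x powr b))"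
      using True by (intro C1 \<phi> g mb A r)
    also have "\<dots> \<le> ennreal (C1 * A * (r powr a * (2 powr \<bar>b\<bar> * (norm x + r) powr b)))"
      using True r A C1 by (intro ennreal_leI mult_left_mono powr_le_of_comparable) auto
    also have "\<dots> = ennreal ((C1 * 2 powr \<bar>b\<bar>) * (A * (r powr a * (norm x + r) powr b)))"
      by (simp add: mult_ac)
    also have "\<dots> \<le> ennreal (C * (A * (r powr a * (norm x + r) powr b)))"
      using K A by (intro ennreal_leI mult_right_mono) (auto simp: C_def)
    finally show ?thesis by (simp add: mult.assoc)
  next
    case False
    have \<phi>_meas [measurable]: "\<phi> \<in> borel_measurable borel"
      using \<phi> by (simp add: local_maximal_bound_def)
    have xr: "0 < norm x + r \<and> norm x + r \<le> 5 * r \<and> r \<le> 5 * (norm x + r)"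
      using r False norm_ge_zero[of x] by argo
    have "(\<integral>\<^sup>+ y \<in> ball x r. (\<phi> (maximal g y) * ennreal (norm y powr \<beta>)) \<partial>lebesgue)
      \<le> (\<integral>\<^sup>+ y \<in> ball (0::'a) (5 * r). (\<phi> (maximal g y) * ennreal (norm y powr \<beta>)) \<partial>lebesgue)"
    proof (intro set_nn_integral_subset_le subsetI)
      fix y assume "y \<in> ball x r"
      then show "y \<in> ball 0 (5 * r)"
        using False norm_triangle_ineq2[of y x] by (simp add: dist_norm norm_minus_commute)
    qed
    also have "\<dots> \<le> ennreal (C2 * A / (1 - 2 powr - (a + b)) * (5 * r) powr (a + b))"
      using C2 A r ab_pos by (intro set_nn_integral_ball_le_of_shells C2(2)[OF \<phi> g mb A]) auto
    also have "\<dots> = ennreal (C2 / q * 5 powr (a + b) * A * r powr a * r powr b)"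
      unfolding q_def using r by (simp add: powr_mult powr_add mult_ac)
    also have "\<dots> \<le> ennreal (C2 / q * 5 powr (a + b) * A * r powr a * (5 powr \<bar>b\<bar> * (norm x + r) powr b))"
      using C2 q A xr by (intro ennreal_leI mult_left_mono powr_le_of_comparable) auto
    also have "\<dots> = ennreal (K * (A * (r powr a * (norm x + r) powr b)))"
      by (simp add: K_def mult_ac)
    also have "\<dots> \<le> ennreal (C * (A * (r powr a * (norm x + r) powr b)))"
      using C1 A by (intro ennreal_leI mult_right_mono) (auto simp: C_def)
    finally show ?thesis by (simp add: mult.assoc)
  qed
  moreover have "0 < C" using C1 K by (simp add: C_def add_pos_pos)
  ultimately show ?thesis by blast
qed

end

section \<open>Morrey norms for power weights\<close>

lemma ennpow_divide_le_iff:
  assumes "0 < p" "0 < d" "0 \<le> K"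
  shows "ennpow (I / ennreal d) (1 / p) \<le> ennreal K \<longleftrightarrow> I \<le> ennreal (K powr p * d)"
proof (cases I)
  case top
  then show ?thesis
    using assms by (simp add: ennreal_top_divide ennpow_top top_unique)
next
  case (real i)
  have "(i / d) powr (1 / p) \<le> K \<longleftrightarrow> i / d \<le> K powr p"
  proof
    assume "(i / d) powr (1 / p) \<le> K"
    then have "((i / d) powr (1 / p)) powr p \<le> K powr p"
      using assms by (intro powr_mono2) auto
    then show "i / d \<le> K powr p"
      using assms real by (simp add: powr_powr)
  next
    assume "i / d \<le> K powr p"
    then have "(i / d) powr (1 / p) \<le> (K powr p) powr (1 / p)"
      using assms real by (intro powr_mono2) auto
    then show "(i / d) powr (1 / p) \<le> K"
      using assms by (simp add: powr_powr)
  qed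
  then show ?thesis
    using assms real by (simp add: divide_ennreal ennpow_ennreal_nonneg ennreal_le_iff pos_divide_le_eq)
qed

text \<open>The weight of the ball is comparable to r^n (|x| + r)^\<beta>, and
  \<open>n * q = l\<^sub>2\<close> turns its q-th power into the model. The constant works for
  either sign of \<open>l\<^sub>2\<close>, and the extended-real denominator becomes a positive real
  \<open>d\<close>.\<close>

lemma morrey_denominator:
  fixes \<beta> l\<^sub>1 l\<^sub>2 :: real
  assumes \<beta>: "- real DIM('a::euclidean_space) < \<beta>"
  defines "q \<equiv> l\<^sub>2 / real DIM('a)"
  shows "\<exists>\<kappa>\<ge>1. \<forall>(x::'a) r. 0 < r \<longrightarrow> (\<exists>d>0.
    ennreal (r powr l\<^sub>1) * ennpow (weight_measure (power_weight \<beta>) (ball x r)) q = ennreal d \<and>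
    d \<le> \<kappa> * (r powr (l\<^sub>1 + l\<^sub>2) * (norm x + r) powr (\<beta> * q)) \<and>
    r powr (l\<^sub>1 + l\<^sub>2) * (norm x + r) powr (\<beta> * q) \<le> \<kappa> * d)"
proof -
  define n :: real where "n = DIM('a)"
  have n: "0 < n" by (simp add: n_def)
  obtain c where c: "0 < c" "\<And>(x::'a) r. 0 < r \<Longrightarrow>
    ennreal (c * (r powr n * (norm x + r) powr \<beta>)) \<le> (\<integral>\<^sup>+ y \<in> ball x r. ennreal (norm y powr \<beta>) \<partial>lebesgue)"
    unfolding n_def using weight_ball_lower[of \<beta>, where 'a = 'a] by blast
  obtain C where C: "0 < C" "\<And>(x::'a) r. 0 < r \<Longrightarrow>
    (\<integral>\<^sup>+ y \<in> ball x r. ennreal (norm y powr \<beta>) \<partial>lebesgue) \<le> ennreal (C * (r powr n * (norm x + r) powr \<beta>))"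
    unfolding n_def using weight_ball_upper[OF \<beta>] by blast
  define k where "k = max 1 (max C (1 / c))"
  define \<kappa> where "\<kappa> = k powr \<bar>q\<bar>"
  have k: "1 \<le> k" "C \<le> k" "1 / c \<le> k" by (auto simp: k_def)
  have \<kappa>: "1 \<le> \<kappa>" using k(1) by (simp add: \<kappa>_def ge_one_powr_ge_zero)
  have "\<exists>d>0.
    ennreal (r powr l\<^sub>1) * ennpow (weight_measure (power_weight \<beta>) (ball x r)) q = ennreal d \<and>
    d \<le> \<kappa> * (r powr (l\<^sub>1 + l\<^sub>2) * (norm x + r) powr (\<beta> * q)) \<and>
    r powr (l\<^sub>1 + l\<^sub>2) * (norm x + r) powr (\<beta> * q) \<le> \<kappa> * d" if r: "0 < r" for x :: 'a and r
  proof -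
    define Z where "Z = r powr n * (norm x + r) powr \<beta>"
    have xr: "0 < norm x + r" using r norm_ge_zero[of x] by linarith
    have Z: "0 < Z" using r xr by (simp add: Z_def)
    have wm: "weight_measure (power_weight \<beta>) (ball x r) = (\<integral>\<^sup>+ y \<in> ball x r. ennreal (norm y powr \<beta>) \<partial>lebesgue)"
      by (simp add: weight_measure_def power_weight_def)
    have le: "weight_measure (power_weight \<beta>) (ball x r) \<le> ennreal (C * Z)"
      and ge: "ennreal (c * Z) \<le> weight_measure (power_weight \<beta>) (ball x r)"
      using C(2)[OF r, of x] c(2)[OF r, of x] by (simp_all add: wm Z_def)
    obtain W where W: "0 \<le> W" "weight_measure (power_weight \<beta>) (ball x r) = ennreal W"
      using le by (cases "weight_measure (power_weight \<beta>) (ball x r)") (auto simp: top_unique)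
    have WZ: "W \<le> C * Z" "c * Z \<le> W"
      using le ge W C(1) c(1) Z by (simp_all add: ennreal_le_iff)
    have "0 < c * Z" using c Z by simp
    then have W0: "0 < W" using WZ by linarith
    have WZ': "W \<le> k * Z" using WZ(1) mult_right_mono[OF k(2), of Z] Z by linarith
    have "Z \<le> (1 / c) * W" using WZ(2) c(1) by (simp add: field_simps)
    then have ZW': "Z \<le> k * W" using mult_right_mono[OF k(3), of W] W0 by linarith
    have le1: "W powr q \<le> \<kappa> * Z powr q" and le2: "Z powr q \<le> \<kappa> * W powr q"
      unfolding \<kappa>_def using Z W0 k(1) WZ' ZW' by (intro powr_le_of_comparable; simp)+
    have G: "r powr (l\<^sub>1 + l\<^sub>2) * (norm x + r) powr (\<beta> * q) = r powr l\<^sub>1 * Z powr q"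
      using r xr n by (simp add: Z_def powr_mult powr_powr powr_add q_def flip: n_def)
    show ?thesis
    proof (intro exI[of _ "r powr l\<^sub>1 * W powr q"] conjI)
      show "ennreal (r powr l\<^sub>1) * ennpow (weight_measure (power_weight \<beta>) (ball x r)) q = ennreal (r powr l\<^sub>1 * W powr q)"
        using W0 by (simp add: W(2) ennpow_ennreal ennreal_mult)
      show "r powr l\<^sub>1 * W powr q \<le> \<kappa> * (r powr (l\<^sub>1 + l\<^sub>2) * (norm x + r) powr (\<beta> * q))"
        using mult_left_mono[OF le1, of "r powr l\<^sub>1"] unfolding G by (simp add: mult_ac)
      show "r powr (l\<^sub>1 + l\<^sub>2) * (norm x + r) powr (\<beta> * q) \<le> \<kappa> * (r powr l\<^sub>1 * W powr q)"
        using mult_left_mono[OF le2, of "r powr l\<^sub>1"] unfolding G by (simp add: mult_ac)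
    qed (use r W0 in simp)
  qed
  with \<kappa> show ?thesis by blast
qed

text \<open>Estimates are available for real K > 0 above the norm. A zero norm is not itself such a
  K, so there the conclusion is reached by letting K tend to 0.\<close>

lemma le_mult_ennrealI:
  assumes "0 \<le> C" "N < top" "\<And>K. 0 < K \<Longrightarrow> N \<le> ennreal K \<Longrightarrow> X \<le> ennreal (C * K)"
  shows "X \<le> ennreal C * N"
proof (cases N)
  case (real \<nu>)
  show ?thesis
  proof (cases "\<nu> = 0")
    case True
    have "X \<le> 0 + ennreal \<epsilon>" if "0 < \<epsilon>" for \<epsilon>
    proof -
      \<comment> \<open>Dividing by C + 1 rather than C covers C = 0.\<close>
      have "X \<le> ennreal (C * (\<epsilon> / (C + 1)))"
        using that assms(1) real True by (intro assms(3)) auto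
      also have "\<dots> \<le> ennreal \<epsilon>"
        using that assms(1) by (intro ennreal_leI) (simp add: field_simps)
      finally show ?thesis by simp
    qed
    then have "X \<le> 0" by (rule ennreal_le_epsilon)
    then show ?thesis by simp
  next
    case False
    then have "X \<le> ennreal (C * \<nu>)"
      using real by (intro assms(3)) auto
    then show ?thesis using real assms(1) by (simp add: ennreal_mult)
  qed
qed (use assms in simp)

lemma less_e2ennreal_iff:
  assumes "0 \<le> t" "0 \<le> z"
  shows "ennreal t < e2ennreal z \<longleftrightarrow> ereal t < z"
  using assms by (cases z) (auto simp: e2ennreal_ereal ennreal_less_iff)

section \<open>The power functions behind necessity\<close>

text \<open>For \<sigma> > 0 the averages over B(x, r) grow like r^\<sigma>. For \<sigma> \<le> -n,
  infinitely many disjoint balls accumulate at the origin, each with mass bounded below, so a ball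
  containing both the origin and x has infinite mass.\<close>

lemma maximal_power_weight_top:
  fixes \<sigma> :: real and x :: "'a::euclidean_space"
  assumes \<sigma>: "0 < \<sigma> \<or> \<sigma> \<le> - real DIM('a)"
  shows "maximal (\<lambda>y::'a. ennreal (norm y powr \<sigma>)) x = top"
proof (rule ccontr)
  assume nt: "maximal (\<lambda>y::'a. ennreal (norm y powr \<sigma>)) x \<noteq> top"
  then obtain m where m: "0 \<le> m" "maximal (\<lambda>y::'a. ennreal (norm y powr \<sigma>)) x = ennreal m"
    by (cases "maximal (\<lambda>y::'a. ennreal (norm y powr \<sigma>)) x") auto
  define n :: real where "n = DIM('a)"
  define \<omega> where "\<omega> = unit_ball_vol n"
  have \<omega>: "0 < \<omega>" by (simp add: \<omega>_def n_def)
  obtain c where c: "0 < c" "\<And>(x::'a) r. 0 < r \<Longrightarrow>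
    ennreal (c * (r powr n * (norm x + r) powr \<sigma>)) \<le> (\<integral>\<^sup>+ y \<in> ball x r. ennreal (norm y powr \<sigma>) \<partial>lebesgue)"
    unfolding n_def using weight_ball_lower[of \<sigma>, where 'a = 'a] by blast
  have le: "(\<integral>\<^sup>+ y \<in> ball z r. ennreal (norm y powr \<sigma>) \<partial>lebesgue) \<le> ennreal (m * \<omega> * r powr n)"
    if "0 < r" "x \<in> ball z r" for z r
    using le_maximal[OF that, of "\<lambda>y. ennreal (norm y powr \<sigma>)"] m \<omega>
    by (simp add: \<omega>_def n_def mult.assoc flip: ennreal_mult)
  show False
  proof (cases "0 < \<sigma>")
    case True
    \<comment> \<open>Chosen so that c r^\<sigma> = m \<omega> + 1, just beyond what a finite value
      m permits.\<close>
    define r where "r = ((m * \<omega> + 1) / c) powr (1 / \<sigma>)"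
    have m\<omega>: "0 < m * \<omega> + 1" using m \<omega> by (simp add: add_nonneg_pos)
    have r: "0 < r" using m\<omega> c by (simp add: r_def)
    have "r powr \<sigma> = (m * \<omega> + 1) / c"
      using m\<omega> c True by (simp add: r_def powr_powr)
    then have "m * \<omega> + 1 = c * r powr \<sigma>"
      using c by simp
    also have "\<dots> \<le> c * (norm x + r) powr \<sigma>"
      using c r True by (intro mult_left_mono powr_mono2) auto
    finally have "(m * \<omega> + 1) * r powr n \<le> c * (norm x + r) powr \<sigma> * r powr n"
      by (intro mult_right_mono) auto
    moreover have "ennreal (c * (r powr n * (norm x + r) powr \<sigma>)) \<le> ennreal (m * \<omega> * r powr n)"
      using c(2)[OF r, of x] le[OF r, of x] r by simp
    then have "c * (r powr n * (norm x + r) powr \<sigma>) \<le> m * \<omega> * r powr n"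
      using m \<omega> by (simp add: ennreal_le_iff)
    moreover have "0 < r powr n" using r by simp
    ultimately show False by (simp add: algebra_simps)
  next
    case False
    then have \<sigma>n: "n + \<sigma> \<le> 0" using \<sigma> by (simp add: n_def)
    obtain u :: 'a where u: "norm u = 1"
      using vector_choose_size[of 1] by auto
    \<comment> \<open>Radius r k at distance 6 r k places the k-th ball between the radii 5 r k and
      7 r k. Radii at least halve from one index to a larger one and 7/2 < 5, so the balls are
      disjoint; the 8 gives 7 r k \<le> 1, so all lie in the unit ball.\<close>
    define r :: "nat \<Rightarrow> real" where "r k = 1 / (8 * 2 ^ k)" for k
    define z where "z k = (6 * r k) *\<^sub>R u" for k
    have r: "0 < r k" "r k \<le> 1" for k
    proof -
      have "(1::real) \<le> 8 * 2 ^ k" using one_le_power[of "2::real" k] by linarith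
      then show "0 < r k" "r k \<le> 1" unfolding r_def by (simp_all add: field_simps)
    qed
    have nz: "norm (z k) = 6 * r k" for k
      using u r[of k] by (simp add: z_def)
    have annulus: "5 * r k < norm y \<and> norm y < 7 * r k" if "y \<in> ball (z k) (r k)" for y k
    proof -
      have "norm (y - z k) < r k" using that by (simp add: dist_norm norm_minus_commute)
      then show ?thesis
        using nz[of k] norm_triangle_ineq2[of y "z k"] norm_triangle_ineq2[of "z k" y] by (auto simp: norm_minus_commute)
    qed
    have half: "2 * r j \<le> r k" if "k < j" for j k
    proof -
      have "(2::real) ^ Suc k \<le> 2 ^ j" using that by (intro power_increasing) auto
      then show ?thesis by (simp add: r_def field_simps)
    qed
    have disj: "disjoint_family (\<lambda>k. ball (z k) (r k))"
      unfolding disjoint_family_on_def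
    proof (intro ballI impI)
      fix i j :: nat assume ij: "i \<noteq> j"
      show "ball (z i) (r i) \<inter> ball (z j) (r j) = {}"
      proof (rule ccontr)
        assume "\<not> ?thesis"
        then obtain y where y: "y \<in> ball (z i) (r i)" "y \<in> ball (z j) (r j)" by auto
        have "5 * r i < 7 * r j" "5 * r j < 7 * r i"
          using annulus[OF y(1)] annulus[OF y(2)] by linarith+
        moreover have "2 * r j \<le> r i \<or> 2 * r i \<le> r j"
          using half[of i j] half[of j i] ij by linarith
        ultimately show False
          using r(1)[of i] r(1)[of j] by argo
      qed
    qed
    define c' where "c' = c * 7 powr \<sigma>"
    have c': "0 < c'" using c by (simp add: c'_def)
    define \<nu> where "\<nu> = density lebesgue (\<lambda>y::'a. ennreal (norm y powr \<sigma>))"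
    have \<nu>: "emeasure \<nu> A = (\<integral>\<^sup>+ y \<in> A. ennreal (norm y powr \<sigma>) \<partial>lebesgue)" if "A \<in> sets lebesgue" for A
      using that by (simp add: \<nu>_def emeasure_density weight_measurable_lebesgue)
    have [simp]: "sets \<nu> = sets lebesgue" by (simp add: \<nu>_def)
    have each: "ennreal c' \<le> emeasure \<nu> (ball (z k) (r k))" for k
    proof -
      \<comment> \<open>The mass of the k-th ball scales like (r k)^(n + \<sigma>), which does not
        decay because n + \<sigma> \<le> 0.\<close>
      have "1 \<le> r k powr (n + \<sigma>)"
        using powr_mono2'[of "n + \<sigma>" "r k" 1] \<sigma>n r[of k] by simp
      then have "c' * 1 \<le> c' * r k powr (n + \<sigma>)"
        using c' by (intro mult_left_mono) auto
      also have "\<dots> = c * (r k powr n * (norm (z k) + r k) powr \<sigma>)"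
        using r(1)[of k] by (simp add: c'_def nz powr_mult powr_add)
      finally have "ennreal c' \<le> ennreal (c * (r k powr n * (norm (z k) + r k) powr \<sigma>))"
        by (intro ennreal_leI) simp
      also have "\<dots> \<le> emeasure \<nu> (ball (z k) (r k))"
        using c(2)[OF r(1)[of k], of "z k"] by (simp add: \<nu>)
      finally show ?thesis .
    qed
    have "top = (\<Sum>k::nat. ennreal c')"
      using c' by (simp add: suminf_eq_SUP ennreal_SUP_of_nat_eq_top ennreal_mult_top flip: SUP_mult_right_ennreal)
    also have "\<dots> \<le> (\<Sum>k. emeasure \<nu> (ball (z k) (r k)))"
      by (intro suminf_le each summableI)
    also have "\<dots> = emeasure \<nu> (\<Union>k. ball (z k) (r k))"
      using disj by (intro suminf_emeasure) auto
    also have "\<dots> \<le> emeasure \<nu> (ball 0 (norm x + 1))"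
    proof (intro emeasure_mono UN_least subsetI)
      fix k y assume "y \<in> ball (z k) (r k)"
      then have "norm y < 7 * r k" using annulus by blast
      moreover have "(7::real) \<le> 8 * 2 ^ k" using one_le_power[of "2::real" k] by linarith
      then have "7 * r k \<le> 1" by (simp add: r_def field_simps)
      ultimately have "norm y < norm x + 1" using norm_ge_zero[of x] by linarith
      then show "y \<in> ball 0 (norm x + 1)" by simp
    qed auto
    also have "\<dots> \<le> ennreal (m * \<omega> * (norm x + 1) powr n)"
      using le[of "norm x + 1" 0] norm_ge_zero[of x] by (simp add: \<nu> add_nonneg_pos)
    finally show False by (simp add: top_unique)
  qed
qed

text \<open>The p-th power times the weight is |y|^(a + b - n), integrable at the origin because a +
  b > 0. The weight estimate then gives r^n (|x| + r)^(a + b - n), and a < n allows (|x| + r)^(a -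
  n) to be replaced by r^(a - n).\<close>

lemma power_morrey_bounded:
  fixes a b \<beta> p :: real
  assumes p: "1 \<le> p" and ab: "0 < a + b" and a: "a < real DIM('a::euclidean_space)"
  shows "\<exists>A>0. morrey_bounded p a b \<beta> (\<lambda>y::'a. ennreal (norm y powr ((a + b - \<beta> - real DIM('a)) / p))) A"
proof -
  define n :: real where "n = DIM('a)"
  define e where "e = a + b - \<beta> - n"
  obtain C where C: "0 < C" "\<And>(x::'a) r. 0 < r \<Longrightarrow>
    (\<integral>\<^sup>+ y \<in> ball x r. ennreal (norm y powr (e + \<beta>)) \<partial>lebesgue) \<le> ennreal (C * (r powr n * (norm x + r) powr (e + \<beta>)))"
    unfolding n_def using weight_ball_upper[of "e + \<beta>", where 'a = 'a] ab by (auto simp: e_def n_def)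
  have "morrey_bounded p a b \<beta> (\<lambda>y::'a. ennreal (norm y powr (e / p))) C"
    unfolding morrey_bounded_def
  proof (intro allI impI)
    fix x :: 'a and r :: real assume r: "0 < r"
    have xr: "0 < norm x + r" using r norm_ge_zero[of x] by linarith
    have "ennpow (ennreal (norm y powr (e / p))) p * ennreal (norm y powr \<beta>) = ennreal (norm y powr (e + \<beta>))" for y :: 'a
      using p by (simp add: ennpow_ennreal_nonneg powr_powr powr_add ennreal_mult)
    then have "(\<integral>\<^sup>+ y \<in> ball x r. (ennpow (ennreal (norm y powr (e / p))) p * ennreal (norm y powr \<beta>)) \<partial>lebesgue)
      \<le> ennreal (C * (r powr n * (norm x + r) powr (e + \<beta>)))"
      using C(2)[OF r, of x] by simp
    also have "\<dots> = ennreal (C * (r powr n * ((norm x + r) powr (a - n) * (norm x + r) powr b)))"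
      by (simp add: e_def algebra_simps flip: powr_add)
    also have "\<dots> \<le> ennreal (C * (r powr n * (r powr (a - n) * (norm x + r) powr b)))"
      using C(1) r a by (intro ennreal_leI mult_left_mono mult_right_mono powr_mono2') (auto simp: n_def)
    also have "\<dots> = ennreal (C * (r powr a * (norm x + r) powr b))"
      using r by (simp add: powr_diff)
    finally show "(\<integral>\<^sup>+ y \<in> ball x r. (ennpow (ennreal (norm y powr (e / p))) p * ennreal (norm y powr \<beta>)) \<partial>lebesgue)
      \<le> ennreal (C * (r powr a * (norm x + r) powr b))" .
  qed
  with C(1) show ?thesis by (auto simp: e_def n_def)
qed

context
  fixes \<beta> l\<^sub>1 l\<^sub>2 a b n :: real and dim :: "'a::euclidean_space itself"
  assumes n_def: "n = real DIM('a)" and \<beta>: "- n < \<beta>"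
    and a_def: "a = l\<^sub>1 + l\<^sub>2" and b_def: "b = \<beta> * (l\<^sub>2 / n)"
begin

lemma denominator_comparable:
  "\<exists>\<kappa>\<ge>1. \<forall>(x::'a) r. 0 < r \<longrightarrow> (\<exists>d>0.
    ennreal (r powr l\<^sub>1) * ennpow (weight_measure (power_weight \<beta>) (ball x r)) (l\<^sub>2 / real DIM('a)) = ennreal d \<and>
    d \<le> \<kappa> * (r powr a * (norm x + r) powr b) \<and> r powr a * (norm x + r) powr b \<le> \<kappa> * d)"
  unfolding a_def b_def n_def by (rule morrey_denominator) (use \<beta> n_def in simp)

text \<open>The denominators involve neither p nor f, so one \<kappa> serves them all.\<close>

lemma morrey_norm_morrey_bounded:
  "\<exists>\<kappa>>0. \<forall>p (f :: 'a \<Rightarrow> ereal). 1 \<le> p \<longrightarrow>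
    (\<forall>K\<ge>0. morrey_norm p l\<^sub>1 l\<^sub>2 (power_weight \<beta>) f \<le> ennreal K \<longrightarrow>
      morrey_bounded p a b \<beta> (\<lambda>y. e2ennreal \<bar>f y\<bar>) (\<kappa> * K powr p)) \<and>
    (\<forall>A\<ge>0. morrey_bounded p a b \<beta> (\<lambda>y. e2ennreal \<bar>f y\<bar>) A \<longrightarrow>
      morrey_norm p l\<^sub>1 l\<^sub>2 (power_weight \<beta>) f \<le> ennreal ((\<kappa> * A) powr (1 / p)))"
proof -
  obtain \<kappa> where \<kappa>: "1 \<le> \<kappa>" and ex: "\<forall>(x::'a) r. 0 < r \<longrightarrow> (\<exists>d>0.
    ennreal (r powr l\<^sub>1) * ennpow (weight_measure (power_weight \<beta>) (ball x r)) (l\<^sub>2 / real DIM('a)) = ennreal d \<and>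
    d \<le> \<kappa> * (r powr a * (norm x + r) powr b) \<and> r powr a * (norm x + r) powr b \<le> \<kappa> * d)"
    using denominator_comparable by blast
  have "morrey_bounded p a b \<beta> (\<lambda>y. e2ennreal \<bar>f y\<bar>) (\<kappa> * K powr p)"
    if p: "1 \<le> p" and K: "0 \<le> K" and le: "morrey_norm p l\<^sub>1 l\<^sub>2 (power_weight \<beta>) f \<le> ennreal K"
    for p K and f :: "'a \<Rightarrow> ereal"
    unfolding morrey_bounded_def
  proof (intro allI impI)
    fix x :: 'a and r :: real assume r: "0 < r"
    define I where "I = (\<integral>\<^sup>+ y \<in> ball x r. (ennpow (e2ennreal \<bar>f y\<bar>) p * ennreal (norm y powr \<beta>)) \<partial>lebesgue)"
    obtain d where d: "0 < d" "ennreal (r powr l\<^sub>1) * ennpow (weight_measure (power_weight \<beta>) (ball x r)) (l\<^sub>2 / real DIM('a)) = ennreal d"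
      "d \<le> \<kappa> * (r powr a * (norm x + r) powr b)"
      using ex r by blast
    have "ennpow (I / ennreal d) (1 / p) \<le> morrey_norm p l\<^sub>1 l\<^sub>2 (power_weight \<beta>) f"
      unfolding morrey_norm_def I_def d(2)[symmetric] power_weight_def
      by (rule SUP_upper2[OF UNIV_I, of _ _ x], rule SUP_upper2[of r]) (use r in simp_all)
    then have "I \<le> ennreal (K powr p * d)"
      using ennpow_divide_le_iff[of p d K I] p K d(1) le by auto
    also have "\<dots> \<le> ennreal (K powr p * (\<kappa> * (r powr a * (norm x + r) powr b)))"
      using d by (intro ennreal_leI mult_left_mono) auto
    finally show "I \<le> ennreal (\<kappa> * K powr p * (r powr a * (norm x + r) powr b))"
      by (simp add: mult_ac)
  qed
  moreover have "morrey_norm p l\<^sub>1 l\<^sub>2 (power_weight \<beta>) f \<le> ennreal ((\<kappa> * A) powr (1 / p))"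
    if p: "1 \<le> p" and A: "0 \<le> A" and mb: "morrey_bounded p a b \<beta> (\<lambda>y. e2ennreal \<bar>f y\<bar>) A"
    for p A and f :: "'a \<Rightarrow> ereal"
    unfolding morrey_norm_def
  proof (intro SUP_least)
    fix x :: 'a and r :: real assume "r \<in> {0<..}"
    then have r: "0 < r" by simp
    define I where "I = (\<integral>\<^sup>+ y \<in> ball x r. (ennpow (e2ennreal \<bar>f y\<bar>) p * ennreal (norm y powr \<beta>)) \<partial>lebesgue)"
    obtain d where d: "0 < d" "ennreal (r powr l\<^sub>1) * ennpow (weight_measure (power_weight \<beta>) (ball x r)) (l\<^sub>2 / real DIM('a)) = ennreal d"
      "r powr a * (norm x + r) powr b \<le> \<kappa> * d"
      using ex r by blast
    have "I \<le> ennreal (A * (r powr a * (norm x + r) powr b))"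
      using mb r by (simp add: morrey_bounded_def I_def)
    also have "\<dots> \<le> ennreal (A * (\<kappa> * d))"
      using A d by (intro ennreal_leI mult_left_mono) auto
    also have "A * (\<kappa> * d) = ((\<kappa> * A) powr (1 / p)) powr p * d"
      using A \<kappa> p by (simp add: powr_powr)
    finally have "ennpow (I / ennreal d) (1 / p) \<le> ennreal ((\<kappa> * A) powr (1 / p))"
      using p d(1) by (subst ennpow_divide_le_iff) auto
    then show "ennpow ((\<integral>\<^sup>+ y \<in> ball x r. (ennpow (e2ennreal \<bar>f y\<bar>) p * ennreal (power_weight \<beta> y)) \<partial>lebesgue) /
          (ennreal (r powr l\<^sub>1) * ennpow (weight_measure (power_weight \<beta>) (ball x r)) (l\<^sub>2 / real DIM('a)))) (1 / p)
      \<le> ennreal ((\<kappa> * A) powr (1 / p))"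
      unfolding d(2) by (simp add: I_def power_weight_def)
  qed
  ultimately show ?thesis
    using \<kappa> by (intro exI[of _ \<kappa>]) auto
qed

text \<open>The weak norm has |B|^(\<open>l\<^sub>1\<close>/n) where the strong one has
  r^\<open>l\<^sub>1\<close>; the quotient is the constant \<theta>. The hypothesis writes the
  weight of a level set as an integral, the form that the estimates for a general \<phi>
  deliver.\<close>

lemma weak_morrey_norm_le:
  "\<exists>\<kappa>>0. \<forall>(f :: 'a \<Rightarrow> ereal) A. 0 \<le> A \<longrightarrow>
    (\<forall>t x r. 0 < t \<longrightarrow> 0 < r \<longrightarrow>
      (\<integral>\<^sup>+ y \<in> ball x r. (ennreal t * indicator {ennreal t<..} (e2ennreal \<bar>f y\<bar>) * ennreal (norm y powr \<beta>)) \<partial>lebesgue)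
        \<le> ennreal (A * (r powr a * (norm x + r) powr b))) \<longrightarrow>
    f \<in> borel_measurable lebesgue \<longrightarrow>
    weak_morrey_norm 1 l\<^sub>1 l\<^sub>2 (power_weight \<beta>) f \<le> ennreal (\<kappa> * A)"
proof -
  obtain \<kappa> where \<kappa>: "1 \<le> \<kappa>" and ex: "\<forall>(x::'a) r. 0 < r \<longrightarrow> (\<exists>d>0.
    ennreal (r powr l\<^sub>1) * ennpow (weight_measure (power_weight \<beta>) (ball x r)) (l\<^sub>2 / real DIM('a)) = ennreal d \<and>
    d \<le> \<kappa> * (r powr a * (norm x + r) powr b) \<and> r powr a * (norm x + r) powr b \<le> \<kappa> * d)"
    using denominator_comparable by blast
  define \<omega> where "\<omega> = unit_ball_vol n"
  have n: "0 < n" by (simp add: n_def)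
  have \<omega>: "0 < \<omega>" using n by (simp add: \<omega>_def)
  define \<theta> where "\<theta> = \<omega> powr (l\<^sub>1 / n)"
  have \<theta>: "0 < \<theta>" using \<omega> by (simp add: \<theta>_def)
  have "weak_morrey_norm 1 l\<^sub>1 l\<^sub>2 (power_weight \<beta>) f \<le> ennreal (\<kappa> / \<theta> * A)"
    if A: "0 \<le> A" and le: "\<And>t x r. 0 < t \<Longrightarrow> 0 < r \<Longrightarrow>
      (\<integral>\<^sup>+ y \<in> ball x r. (ennreal t * indicator {ennreal t<..} (e2ennreal \<bar>f y\<bar>) * ennreal (norm y powr \<beta>)) \<partial>lebesgue)
        \<le> ennreal (A * (r powr a * (norm x + r) powr b))"
      and [measurable]: "f \<in> borel_measurable lebesgue"
    for A and f :: "'a \<Rightarrow> ereal"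
    unfolding weak_morrey_norm_def
  proof (intro SUP_least)
    fix x :: 'a and r t :: real assume "r \<in> {0<..}" "t \<in> {0<..}"
    then have r: "0 < r" and t: "0 < t" by auto
    define I where "I = ennreal (t powr 1) * weight_measure (power_weight \<beta>) {y \<in> ball x r. ereal t < \<bar>f y\<bar>}"
    obtain d where d: "0 < d" "ennreal (r powr l\<^sub>1) * ennpow (weight_measure (power_weight \<beta>) (ball x r)) (l\<^sub>2 / real DIM('a)) = ennreal d"
      "r powr a * (norm x + r) powr b \<le> \<kappa> * d"
      using ex r by blast
    have den: "ennpow (emeasure lebesgue (ball x r)) (l\<^sub>1 / real DIM('a)) *
      ennpow (weight_measure (power_weight \<beta>) (ball x r)) (l\<^sub>2 / real DIM('a)) = ennreal (\<theta> * d)"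
    proof -
      have "ennpow (emeasure lebesgue (ball x r)) (l\<^sub>1 / real DIM('a)) = ennreal ((\<omega> * r powr n) powr (l\<^sub>1 / n))"
        using r \<omega> by (simp add: emeasure_ball_powr ennpow_ennreal flip: n_def \<omega>_def)
      also have "(\<omega> * r powr n) powr (l\<^sub>1 / n) = \<theta> * r powr l\<^sub>1"
        using n by (simp add: powr_mult powr_powr \<theta>_def)
      also have "ennreal (\<theta> * r powr l\<^sub>1) = ennreal \<theta> * ennreal (r powr l\<^sub>1)"
        using \<theta> by (simp add: ennreal_mult)
      finally have "ennpow (emeasure lebesgue (ball x r)) (l\<^sub>1 / real DIM('a)) = ennreal \<theta> * ennreal (r powr l\<^sub>1)" .
      then show ?thesis
        using \<theta> d by (simp add: mult.assoc ennreal_mult)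
    qed
    have "weight_measure (power_weight \<beta>) {y \<in> ball x r. ereal t < \<bar>f y\<bar>}
      = (\<integral>\<^sup>+ y. indicator {ennreal t<..} (e2ennreal \<bar>f y\<bar>) * ennreal (norm y powr \<beta>) * indicator (ball x r) y \<partial>lebesgue)"
      unfolding weight_measure_def using t
      by (intro nn_integral_cong) (auto simp: power_weight_def less_e2ennreal_iff split: split_indicator)
    then have "I = ennreal t * (\<integral>\<^sup>+ y. indicator {ennreal t<..} (e2ennreal \<bar>f y\<bar>) * ennreal (norm y powr \<beta>) * indicator (ball x r) y \<partial>lebesgue)"
      using t by (simp add: I_def)
    also have "\<dots> = (\<integral>\<^sup>+ y. ennreal t * (indicator {ennreal t<..} (e2ennreal \<bar>f y\<bar>) * ennreal (norm y powr \<beta>) * indicator (ball x r) y) \<partial>lebesgue)"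
    proof (rule nn_integral_cmult[symmetric])
      have [measurable]: "ball x r \<in> sets lebesgue" by simp
      show "(\<lambda>y. indicator {ennreal t<..} (e2ennreal \<bar>f y\<bar>) * ennreal (norm y powr \<beta>) * indicator (ball x r) y) \<in> borel_measurable lebesgue"
        using weight_measurable_lebesgue[of \<beta>, where 'a = 'a] by measurable
    qed
    also have "\<dots> \<le> ennreal (A * (r powr a * (norm x + r) powr b))"
      using le[OF t r, of x] by (simp add: mult.assoc)
    also have "\<dots> \<le> ennreal (A * (\<kappa> * d))"
      using A d by (intro ennreal_leI mult_left_mono) auto
    also have "A * (\<kappa> * d) = (\<kappa> / \<theta> * A) powr 1 * (\<theta> * d)"
      using A \<theta> \<kappa> by (simp add: mult_ac)
    finally have "ennpow (I / ennreal (\<theta> * d)) (1 / 1) \<le> ennreal (\<kappa> / \<theta> * A)"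
      using \<theta> \<kappa> A d by (subst ennpow_divide_le_iff) auto
    then show "ennpow (ennreal (t powr 1) * weight_measure (power_weight \<beta>) {y \<in> ball x r. ereal t < \<bar>f y\<bar>} /
        (ennpow (emeasure lebesgue (ball x r)) (l\<^sub>1 / real DIM('a)) *
          ennpow (weight_measure (power_weight \<beta>) (ball x r)) (l\<^sub>2 / real DIM('a)))) (1 / 1)
      \<le> ennreal (\<kappa> / \<theta> * A)"
      unfolding den by (simp add: I_def)
  qed
  moreover have "0 < \<kappa> / \<theta>" using \<kappa> \<theta> by simp
  ultimately show ?thesis by blast
qed

lemma weight_measure_unit_ball:
  "\<exists>W>0. weight_measure (power_weight \<beta>) (ball (0::'a) 1) = ennreal W"
proof -
  obtain c where c: "0 < c" "\<And>(x::'a) r. 0 < r \<Longrightarrow>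
    ennreal (c * (r powr n * (norm x + r) powr \<beta>)) \<le> (\<integral>\<^sup>+ y \<in> ball x r. ennreal (norm y powr \<beta>) \<partial>lebesgue)"
    unfolding n_def using weight_ball_lower[of \<beta>, where 'a = 'a] by blast
  obtain C where C: "0 < C" "\<And>(x::'a) r. 0 < r \<Longrightarrow>
    (\<integral>\<^sup>+ y \<in> ball x r. ennreal (norm y powr \<beta>) \<partial>lebesgue) \<le> ennreal (C * (r powr n * (norm x + r) powr \<beta>))"
    unfolding n_def using weight_ball_upper[OF \<beta>[unfolded n_def]] by blast
  have "ennreal c \<le> weight_measure (power_weight \<beta>) (ball (0::'a) 1)"
    "weight_measure (power_weight \<beta>) (ball (0::'a) 1) \<le> ennreal C"
    using c(2)[of 1 0] C(2)[of 1 0] by (simp_all add: weight_measure_def power_weight_def)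
  then show ?thesis
    using c(1) by (cases "weight_measure (power_weight \<beta>) (ball (0::'a) 1)")
      (auto simp: top_unique intro: less_le_trans)
qed

lemma morrey_norm_infinite:
  fixes f :: "'a \<Rightarrow> ereal"
  assumes p: "1 \<le> p" and f: "\<forall>y. f y = \<infinity>"
  shows "morrey_norm p l\<^sub>1 l\<^sub>2 (power_weight \<beta>) f = top"
proof (rule ccontr)
  assume "morrey_norm p l\<^sub>1 l\<^sub>2 (power_weight \<beta>) f \<noteq> top"
  then obtain K where K: "0 \<le> K" "morrey_norm p l\<^sub>1 l\<^sub>2 (power_weight \<beta>) f \<le> ennreal K"
    by (cases "morrey_norm p l\<^sub>1 l\<^sub>2 (power_weight \<beta>) f") auto
  obtain \<kappa> where \<kappa>: "\<And>p K (f :: 'a \<Rightarrow> ereal). 1 \<le> p \<Longrightarrow> 0 \<le> K \<Longrightarrow> morrey_norm p l\<^sub>1 l\<^sub>2 (power_weight \<beta>) f \<le> ennreal K \<Longrightarrow>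
      morrey_bounded p a b \<beta> (\<lambda>y. e2ennreal \<bar>f y\<bar>) (\<kappa> * K powr p)"
    using morrey_norm_morrey_bounded by blast
  obtain W where W: "0 < W" "weight_measure (power_weight \<beta>) (ball (0::'a) 1) = ennreal W"
    using weight_measure_unit_ball by blast
  have "(\<integral>\<^sup>+ y \<in> ball (0::'a) 1. (ennpow (e2ennreal \<bar>f y\<bar>) p * ennreal (norm y powr \<beta>)) \<partial>lebesgue)
    \<le> ennreal (\<kappa> * K powr p * (1 powr a * (norm (0::'a) + 1) powr b))"
    using \<kappa>[OF p K, unfolded morrey_bounded_def, rule_format, of 1 0] by simp
  moreover have "(\<integral>\<^sup>+ y \<in> ball (0::'a) 1. (ennpow (e2ennreal \<bar>f y\<bar>) p * ennreal (norm y powr \<beta>)) \<partial>lebesgue)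
    = (\<integral>\<^sup>+ y. top * (ennreal (norm y powr \<beta>) * indicator (ball (0::'a) 1) y) \<partial>lebesgue)"
    using p by (simp add: f ennpow_top mult.assoc e2ennreal_infty)
  also have "\<dots> = top * weight_measure (power_weight \<beta>) (ball (0::'a) 1)"
    unfolding weight_measure_def power_weight_def
    by (intro nn_integral_cmult borel_measurable_times_ennreal weight_measurable_lebesgue borel_measurable_indicator) simp
  also have "\<dots> = top"
    using W by (simp add: ennreal_top_mult)
  ultimately show False by (simp add: top_unique)
qed

lemma weak_morrey_norm_infinite:
  fixes f :: "'a \<Rightarrow> ereal"
  assumes f: "\<forall>y. f y = \<infinity>"
  shows "weak_morrey_norm 1 l\<^sub>1 l\<^sub>2 (power_weight \<beta>) f = top"
proof (rule ccontr)
  assume "weak_morrey_norm 1 l\<^sub>1 l\<^sub>2 (power_weight \<beta>) f \<noteq> top"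
  then obtain K where K: "0 \<le> K" "weak_morrey_norm 1 l\<^sub>1 l\<^sub>2 (power_weight \<beta>) f \<le> ennreal K"
    by (cases "weak_morrey_norm 1 l\<^sub>1 l\<^sub>2 (power_weight \<beta>) f") auto
  obtain W where W: "0 < W" "weight_measure (power_weight \<beta>) (ball (0::'a) 1) = ennreal W"
    using weight_measure_unit_ball by blast
  have \<omega>: "0 < unit_ball_vol (real DIM('a))" by simp
  define d where "d = unit_ball_vol (real DIM('a)) powr (l\<^sub>1 / real DIM('a)) * W powr (l\<^sub>2 / real DIM('a))"
  have d: "0 < d" using \<omega> W by (simp add: d_def)
  have den: "ennpow (emeasure lebesgue (ball (0::'a) 1)) (l\<^sub>1 / real DIM('a)) *
      ennpow (weight_measure (power_weight \<beta>) (ball (0::'a) 1)) (l\<^sub>2 / real DIM('a)) = ennreal d"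
    using W \<omega> by (simp add: emeasure_ball_powr ennpow_ennreal d_def ennreal_mult)
  \<comment> \<open>Makes the quotient for the unit ball equal to K + 1, which exceeds the assumed
    bound.\<close>
  define t where "t = (K + 1) * d / W"
  have t: "0 < t" using K d W by (simp add: t_def)
  have "ennpow (ennreal (t powr 1) * weight_measure (power_weight \<beta>) {y \<in> ball (0::'a) 1. ereal t < \<bar>f y\<bar>} / ennreal d) (1 / 1)
    \<le> weak_morrey_norm 1 l\<^sub>1 l\<^sub>2 (power_weight \<beta>) f"
    unfolding weak_morrey_norm_def den[symmetric]
    by (rule SUP_upper2[of 0], simp, rule SUP_upper2[of 1], simp, rule SUP_upper2[of t]) (use t in simp_all)
  moreover have "{y \<in> ball (0::'a) 1. ereal t < \<bar>f y\<bar>} = ball 0 1"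
    by (auto simp: f)
  ultimately have "ennpow (ennreal (t powr 1) * ennreal W / ennreal d) (1 / 1) \<le> ennreal K"
    using K(2) unfolding W(2)[symmetric] by (simp only: order_trans)
  then have "ennpow (ennreal (t * W) / ennreal d) (1 / 1) \<le> ennreal K"
    using t W by (simp add: ennreal_mult)
  then have "ennreal (t * W) \<le> ennreal (K powr 1 * d)"
    using d K by (subst (asm) ennpow_divide_le_iff) auto
  then have "t * W \<le> K * d"
    using d K by (simp add: ennreal_le_iff)
  moreover have "t * W = (K + 1) * d"
    using W by (simp add: t_def)
  ultimately show False
    using d by (simp add: distrib_right)
qed

end

section \<open>The boundedness criterion\<close>

lemma e2ennreal_abs_hl_maximal: "e2ennreal \<bar>hl_maximal f x\<bar> = maximal (\<lambda>y. e2ennreal \<bar>f y\<bar>) x"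
  by (simp add: hl_maximal_eq)

lemma hl_maximal_measurable: "hl_maximal f \<in> borel_measurable lebesgue"
  unfolding hl_maximal_eq[abs_def] by measurable

text \<open>The target enters only through not containing the function that is identically infinite,
  so the strong and the weak case share this argument. If the condition fails, then e/p > 0 or e/p
  \<le> -n, the two cases in which |y|^(e/p) has an infinite maximal function.\<close>

lemma bounded_operator_imp_exponents:
  fixes \<beta> l\<^sub>1 l\<^sub>2 p :: real and Y :: "('a::euclidean_space \<Rightarrow> ereal) set"
  assumes \<beta>: "- real DIM('a) < \<beta>" and p: "1 \<le> p"
    and ab: "0 < l\<^sub>1 + l\<^sub>2 + \<beta> * (l\<^sub>2 / real DIM('a))" and a: "l\<^sub>1 + l\<^sub>2 < real DIM('a)"
    and bdd: "bounded_operator hl_maximal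
      (morrey_space p l\<^sub>1 l\<^sub>2 (power_weight \<beta>)) (morrey_norm p l\<^sub>1 l\<^sub>2 (power_weight \<beta>)) Y N"
    and Y: "\<And>h. h \<in> Y \<Longrightarrow> \<not> (\<forall>y. h y = \<infinity>)"
  defines "e \<equiv> l\<^sub>1 + l\<^sub>2 + \<beta> * (l\<^sub>2 / real DIM('a)) - \<beta> - real DIM('a)"
  shows "e \<le> 0 \<and> 0 < e + real DIM('a) * p"
proof (rule ccontr)
  assume "\<not> ?thesis"
  then have \<sigma>: "0 < e / p \<or> e / p \<le> - real DIM('a)"
    using p by (auto simp: field_simps not_less)
  define f where "f y = ereal (norm y powr (e / p))" for y :: 'a
  have ef: "e2ennreal \<bar>f y\<bar> = ennreal (norm y powr (e / p))" for y
    by (simp add: f_def e2ennreal_ereal)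
  have f_meas: "f \<in> borel_measurable lebesgue"
    unfolding f_def by (intro measurable_completion) simp
  obtain A where A: "0 < A" "morrey_bounded p (l\<^sub>1 + l\<^sub>2) (\<beta> * (l\<^sub>2 / real DIM('a))) \<beta> (\<lambda>y::'a. ennreal (norm y powr (e / p))) A"
    using power_morrey_bounded[OF p ab a, of \<beta>] unfolding e_def by blast
  obtain \<kappa> where \<kappa>: "\<And>p (f :: 'a \<Rightarrow> ereal) A. 1 \<le> p \<Longrightarrow> 0 \<le> A \<Longrightarrow>
      morrey_bounded p (l\<^sub>1 + l\<^sub>2) (\<beta> * (l\<^sub>2 / real DIM('a))) \<beta> (\<lambda>y. e2ennreal \<bar>f y\<bar>) A \<Longrightarrow>
      morrey_norm p l\<^sub>1 l\<^sub>2 (power_weight \<beta>) f \<le> ennreal ((\<kappa> * A) powr (1 / p))"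
    using morrey_norm_morrey_bounded[OF refl \<beta> refl refl, of l\<^sub>1 l\<^sub>2] by blast
  have "morrey_norm p l\<^sub>1 l\<^sub>2 (power_weight \<beta>) f \<le> ennreal ((\<kappa> * A) powr (1 / p))"
    using A by (intro \<kappa> p) (auto simp: ef)
  then have "f \<in> morrey_space p l\<^sub>1 l\<^sub>2 (power_weight \<beta>)"
    using f_meas by (auto simp: morrey_space_def intro: le_less_trans)
  then have "hl_maximal f \<in> Y"
    using bdd by (auto simp: bounded_operator_def)
  moreover have "hl_maximal f y = \<infinity>" for y
    unfolding hl_maximal_eq ef maximal_power_weight_top[OF \<sigma>] by simp
  ultimately show False
    using Y by blast
qed

lemma bounded_operatorI:
  assumes "0 \<le> C" "\<And>f K. f \<in> X \<Longrightarrow> 0 < K \<Longrightarrow> N f \<le> ennreal K \<Longrightarrow> N' (T f) \<le> ennreal (C * K)"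
    and "\<And>f. f \<in> X \<Longrightarrow> N f < top" and "\<And>f. f \<in> X \<Longrightarrow> N' (T f) < top \<Longrightarrow> T f \<in> Y"
  shows "bounded_operator T X N Y N'"
proof -
  have le: "N' (T f) \<le> ennreal C * N f" if "f \<in> X" for f
    using that assms by (intro le_mult_ennrealI) auto
  have "T f \<in> Y" if "f \<in> X" for f
  proof (rule assms(4)[OF that])
    have "ennreal C * N f < top"
      using assms(3)[OF that] by (simp add: ennreal_mult_less_top)
    with le[OF that] show "N' (T f) < top"
      by (rule le_less_trans)
  qed
  with le show ?thesis
    by (auto simp: bounded_operator_def)
qed

lemma maximal_bounded_strong:
  fixes \<beta> l\<^sub>1 l\<^sub>2 p :: real
  assumes \<beta>: "- real DIM('a::euclidean_space) < \<beta>" and p: "1 < p"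
    and ab: "0 < l\<^sub>1 + l\<^sub>2 + \<beta> * (l\<^sub>2 / real DIM('a))" and a: "l\<^sub>1 + l\<^sub>2 < real DIM('a)"
    and e: "l\<^sub>1 + l\<^sub>2 + \<beta> * (l\<^sub>2 / real DIM('a)) - \<beta> - real DIM('a) \<le> 0"
      "0 < l\<^sub>1 + l\<^sub>2 + \<beta> * (l\<^sub>2 / real DIM('a)) - \<beta> - real DIM('a) + real DIM('a) * p"
  defines "w \<equiv> power_weight \<beta> :: 'a \<Rightarrow> real"
  shows "bounded_operator hl_maximal (morrey_space p l\<^sub>1 l\<^sub>2 w) (morrey_norm p l\<^sub>1 l\<^sub>2 w)
    (morrey_space p l\<^sub>1 l\<^sub>2 w) (morrey_norm p l\<^sub>1 l\<^sub>2 w)"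
proof -
  define a where "a = l\<^sub>1 + l\<^sub>2"
  define b where "b = \<beta> * (l\<^sub>2 / real DIM('a))"
  interpret morrey_exponents "TYPE('a)" p a b \<beta> "real DIM('a)" "a + b - \<beta> - real DIM('a)" "unit_ball_vol (real DIM('a))"
    by unfold_locales (use assms in \<open>auto simp: a_def b_def\<close>)
  obtain \<kappa> where \<kappa>: "0 < \<kappa>" "\<And>p K (f :: 'a \<Rightarrow> ereal). 1 \<le> p \<Longrightarrow> 0 \<le> K \<Longrightarrow> morrey_norm p l\<^sub>1 l\<^sub>2 w f \<le> ennreal K \<Longrightarrow>
      morrey_bounded p a b \<beta> (\<lambda>y. e2ennreal \<bar>f y\<bar>) (\<kappa> * K powr p)"
    "\<And>p A (f :: 'a \<Rightarrow> ereal). 1 \<le> p \<Longrightarrow> 0 \<le> A \<Longrightarrow> morrey_bounded p a b \<beta> (\<lambda>y. e2ennreal \<bar>f y\<bar>) A \<Longrightarrow>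
      morrey_norm p l\<^sub>1 l\<^sub>2 w f \<le> ennreal ((\<kappa> * A) powr (1 / p))"
    unfolding w_def using morrey_norm_morrey_bounded[OF refl \<beta> a_def b_def] by blast
  obtain C0 where C0: "0 < C0" "local_maximal_bound TYPE('a) p C0 (\<lambda>x. ennpow x p)"
    using local_maximal_bound_strong[OF p] by blast
  obtain C where C: "0 < C" "\<And>(g :: 'a \<Rightarrow> ennreal) A x r. g \<in> borel_measurable lebesgue \<Longrightarrow>
    morrey_bounded p a b \<beta> g A \<Longrightarrow> 0 < A \<Longrightarrow> 0 < r \<Longrightarrow>
    (\<integral>\<^sup>+ y \<in> ball x r. (ennpow (maximal g y) p * ennreal (norm y powr \<beta>)) \<partial>lebesgue)
      \<le> ennreal (C * A * (r powr a * (norm x + r) powr b))"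
    using maximal_bound[OF C0(1)] C0(2) by blast
  show ?thesis
  proof (rule bounded_operatorI)
    fix f :: "'a \<Rightarrow> ereal" and K :: real
    assume f: "f \<in> morrey_space p l\<^sub>1 l\<^sub>2 w" and K: "0 < K" "morrey_norm p l\<^sub>1 l\<^sub>2 w f \<le> ennreal K"
    have [measurable]: "f \<in> borel_measurable lebesgue" using f by (simp add: morrey_space_def)
    have "morrey_bounded p a b \<beta> (\<lambda>y. e2ennreal \<bar>f y\<bar>) (\<kappa> * K powr p)"
      using p K by (intro \<kappa>) auto
    then have "morrey_bounded p a b \<beta> (maximal (\<lambda>y. e2ennreal \<bar>f y\<bar>)) (C * (\<kappa> * K powr p))"
      unfolding morrey_bounded_def[of p a b \<beta> "maximal _"] using \<kappa>(1) K(1) by (intro allI impI C) auto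
    then have "morrey_norm p l\<^sub>1 l\<^sub>2 w (hl_maximal f) \<le> ennreal ((\<kappa> * (C * (\<kappa> * K powr p))) powr (1 / p))"
      using p \<kappa>(1) C(1) by (intro \<kappa>(3)) (auto simp: e2ennreal_abs_hl_maximal)
    \<comment> \<open>The bound is of degree p in K, so its p-th root is linear in K, as an operator
      bound must be.\<close>
    also have "(\<kappa> * (C * (\<kappa> * K powr p))) powr (1 / p) = (\<kappa> * C * \<kappa>) powr (1 / p) * K"
      using \<kappa>(1) C(1) K(1) p by (simp add: powr_mult powr_powr)
    finally show "morrey_norm p l\<^sub>1 l\<^sub>2 w (hl_maximal f) \<le> ennreal ((\<kappa> * C * \<kappa>) powr (1 / p) * K)" .
  qed (auto simp: morrey_space_def hl_maximal_measurable)
qed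

text \<open>Each height t gives its own \<phi>, but the constant 1 + 5^n of the local estimate is
  independent of t, so one \<open>C\<close> covers the supremum over t in the weak norm.\<close>

lemma maximal_bounded_weak:
  fixes \<beta> l\<^sub>1 l\<^sub>2 :: real
  assumes \<beta>: "- real DIM('a::euclidean_space) < \<beta>"
    and ab: "0 < l\<^sub>1 + l\<^sub>2 + \<beta> * (l\<^sub>2 / real DIM('a))" and a: "l\<^sub>1 + l\<^sub>2 < real DIM('a)"
    and e: "l\<^sub>1 + l\<^sub>2 + \<beta> * (l\<^sub>2 / real DIM('a)) - \<beta> - real DIM('a) \<le> 0"
      "0 < l\<^sub>1 + l\<^sub>2 + \<beta> * (l\<^sub>2 / real DIM('a)) - \<beta> - real DIM('a) + real DIM('a) * 1"
  defines "w \<equiv> power_weight \<beta> :: 'a \<Rightarrow> real"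
  shows "bounded_operator hl_maximal (morrey_space 1 l\<^sub>1 l\<^sub>2 w) (morrey_norm 1 l\<^sub>1 l\<^sub>2 w)
    (weak_morrey_space 1 l\<^sub>1 l\<^sub>2 w) (weak_morrey_norm 1 l\<^sub>1 l\<^sub>2 w)"
proof -
  define a where "a = l\<^sub>1 + l\<^sub>2"
  define b where "b = \<beta> * (l\<^sub>2 / real DIM('a))"
  interpret morrey_exponents "TYPE('a)" 1 a b \<beta> "real DIM('a)" "a + b - \<beta> - real DIM('a)" "unit_ball_vol (real DIM('a))"
    by unfold_locales (use assms in \<open>auto simp: a_def b_def\<close>)
  obtain \<kappa> where \<kappa>: "0 < \<kappa>" "\<And>p K (f :: 'a \<Rightarrow> ereal). 1 \<le> p \<Longrightarrow> 0 \<le> K \<Longrightarrow> morrey_norm p l\<^sub>1 l\<^sub>2 w f \<le> ennreal K \<Longrightarrow>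
      morrey_bounded p a b \<beta> (\<lambda>y. e2ennreal \<bar>f y\<bar>) (\<kappa> * K powr p)"
    unfolding w_def using morrey_norm_morrey_bounded[OF refl \<beta> a_def b_def] by blast
  obtain \<theta> where \<theta>: "0 < \<theta>" "\<And>(f :: 'a \<Rightarrow> ereal) A. 0 \<le> A \<Longrightarrow>
    (\<And>t x r. 0 < t \<Longrightarrow> 0 < r \<Longrightarrow>
      (\<integral>\<^sup>+ y \<in> ball x r. (ennreal t * indicator {ennreal t<..} (e2ennreal \<bar>f y\<bar>) * ennreal (norm y powr \<beta>)) \<partial>lebesgue)
        \<le> ennreal (A * (r powr a * (norm x + r) powr b))) \<Longrightarrow>
    f \<in> borel_measurable lebesgue \<Longrightarrow> weak_morrey_norm 1 l\<^sub>1 l\<^sub>2 w f \<le> ennreal (\<theta> * A)"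
    unfolding w_def using weak_morrey_norm_le[OF refl \<beta> a_def b_def] by blast
  have C0: "0 < 1 + 5 powr real DIM('a)" by (simp add: add_pos_pos)
  obtain C where C: "0 < C" "\<And>\<phi> (g :: 'a \<Rightarrow> ennreal) A x r.
    local_maximal_bound TYPE('a) 1 (1 + 5 powr real DIM('a)) \<phi> \<Longrightarrow> g \<in> borel_measurable lebesgue \<Longrightarrow>
    morrey_bounded 1 a b \<beta> g A \<Longrightarrow> 0 < A \<Longrightarrow> 0 < r \<Longrightarrow>
    (\<integral>\<^sup>+ y \<in> ball x r. (\<phi> (maximal g y) * ennreal (norm y powr \<beta>)) \<partial>lebesgue)
      \<le> ennreal (C * A * (r powr a * (norm x + r) powr b))"
    using maximal_bound[OF C0] by blast
  show ?thesis
  proof (rule bounded_operatorI)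
    fix f :: "'a \<Rightarrow> ereal" and K :: real
    assume f: "f \<in> morrey_space 1 l\<^sub>1 l\<^sub>2 w" and K: "0 < K" "morrey_norm 1 l\<^sub>1 l\<^sub>2 w f \<le> ennreal K"
    have [measurable]: "f \<in> borel_measurable lebesgue" using f by (simp add: morrey_space_def)
    have mb: "morrey_bounded 1 a b \<beta> (\<lambda>y. e2ennreal \<bar>f y\<bar>) (\<kappa> * K)"
      using K \<kappa>(2)[of 1 K f] by simp
    have "weak_morrey_norm 1 l\<^sub>1 l\<^sub>2 w (hl_maximal f) \<le> ennreal (\<theta> * (C * (\<kappa> * K)))"
    proof (rule \<theta>(2))
      fix t r :: real and x :: 'a assume t: "0 < t" and r: "0 < r"
      show "(\<integral>\<^sup>+ y \<in> ball x r. (ennreal t * indicator {ennreal t<..} (e2ennreal \<bar>hl_maximal f y\<bar>) * ennreal (norm y powr \<beta>)) \<partial>lebesgue)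
        \<le> ennreal (C * (\<kappa> * K) * (r powr a * (norm x + r) powr b))"
        unfolding e2ennreal_abs_hl_maximal
        using C(2)[OF local_maximal_bound_weak[OF t] _ mb _ r, of x] \<kappa>(1) K(1) by simp
    qed (use \<kappa>(1) C(1) K(1) in \<open>auto simp: hl_maximal_measurable\<close>)
    then show "weak_morrey_norm 1 l\<^sub>1 l\<^sub>2 w (hl_maximal f) \<le> ennreal (\<theta> * C * \<kappa> * K)"
      by (simp add: mult.assoc)
  qed (use \<theta>(1) C(1) \<kappa>(1) in \<open>auto simp: morrey_space_def weak_morrey_space_def hl_maximal_measurable\<close>)
qed

theorem theorem3p5:
  fixes w :: "'a::euclidean_space \<Rightarrow> real" and \<beta> l\<^sub>1 l\<^sub>2 :: real
  assumes "w = power_weight \<beta>"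
    and "\<beta> > - real DIM('a)"
    and "- l\<^sub>2 * \<beta> / real DIM('a) < l\<^sub>1 + l\<^sub>2"
    and "l\<^sub>1 + l\<^sub>2 < real DIM('a)"
  shows
    "(\<forall>p::real. 1 < p \<longrightarrow>
        (bounded_operator hl_maximal
           (morrey_space p l\<^sub>1 l\<^sub>2 w) (morrey_norm p l\<^sub>1 l\<^sub>2 w)
           (morrey_space p l\<^sub>1 l\<^sub>2 w) (morrey_norm p l\<^sub>1 l\<^sub>2 w)
         \<longleftrightarrow>
         l\<^sub>1 + l\<^sub>2 - real DIM('a) \<le> \<beta> * (1 - l\<^sub>2 / real DIM('a)) \<and>
         \<beta> * (1 - l\<^sub>2 / real DIM('a)) < l\<^sub>1 + l\<^sub>2 + real DIM('a) * (p - 1))) \<and>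
     (bounded_operator hl_maximal
        (morrey_space 1 l\<^sub>1 l\<^sub>2 w) (morrey_norm 1 l\<^sub>1 l\<^sub>2 w)
        (weak_morrey_space 1 l\<^sub>1 l\<^sub>2 w) (weak_morrey_norm 1 l\<^sub>1 l\<^sub>2 w)
      \<longleftrightarrow>
      l\<^sub>1 + l\<^sub>2 - real DIM('a) \<le> \<beta> * (1 - l\<^sub>2 / real DIM('a)) \<and>
      \<beta> * (1 - l\<^sub>2 / real DIM('a)) < l\<^sub>1 + l\<^sub>2 + real DIM('a) * (1 - 1))"
proof -
  define e where "e = l\<^sub>1 + l\<^sub>2 + \<beta> * (l\<^sub>2 / real DIM('a)) - \<beta> - real DIM('a)"
  have w: "w = power_weight \<beta>" by fact
  have \<beta>: "- real DIM('a) < \<beta>" using assms by simp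
  have ab: "0 < l\<^sub>1 + l\<^sub>2 + \<beta> * (l\<^sub>2 / real DIM('a))"
    using assms(3) by (simp add: mult.commute)
  have a: "l\<^sub>1 + l\<^sub>2 < real DIM('a)" by fact
  \<comment> \<open>With b = \<beta> \<open>l\<^sub>2\<close> / n, the middle term of the condition
    is \<beta> - b; moving it across both inequalities produces e.\<close>
  have exponents: "(l\<^sub>1 + l\<^sub>2 - real DIM('a) \<le> \<beta> * (1 - l\<^sub>2 / real DIM('a)) \<and>
      \<beta> * (1 - l\<^sub>2 / real DIM('a)) < l\<^sub>1 + l\<^sub>2 + real DIM('a) * (p - 1))
    \<longleftrightarrow> e \<le> 0 \<and> 0 < e + real DIM('a) * p" for p
    unfolding e_def right_diff_distrib by auto
  show ?thesis
    unfolding exponents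
  proof (intro conjI allI impI iffI)
    fix p :: real assume p: "1 < p"
    assume bdd: "bounded_operator hl_maximal (morrey_space p l\<^sub>1 l\<^sub>2 w) (morrey_norm p l\<^sub>1 l\<^sub>2 w)
      (morrey_space p l\<^sub>1 l\<^sub>2 w) (morrey_norm p l\<^sub>1 l\<^sub>2 w)"
    have "e \<le> 0 \<and> 0 < e + real DIM('a) * p"
      unfolding e_def
    proof (rule bounded_operator_imp_exponents[OF \<beta> _ ab a bdd[unfolded w]])
      show "\<not> (\<forall>y. h y = \<infinity>)" if "h \<in> morrey_space p l\<^sub>1 l\<^sub>2 (power_weight \<beta>)" for h :: "'a \<Rightarrow> ereal"
      proof
        assume "\<forall>y. h y = \<infinity>"
        then have "morrey_norm p l\<^sub>1 l\<^sub>2 (power_weight \<beta>) h = top"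
          using p by (intro morrey_norm_infinite[OF refl \<beta> refl refl]) auto
        with that show False by (simp add: morrey_space_def)
      qed
    qed (use p in simp)
    then show "e \<le> 0" "0 < e + real DIM('a) * p" by auto
  next
    fix p :: real assume "1 < p" "e \<le> 0 \<and> 0 < e + real DIM('a) * p"
    then show "bounded_operator hl_maximal (morrey_space p l\<^sub>1 l\<^sub>2 w) (morrey_norm p l\<^sub>1 l\<^sub>2 w)
      (morrey_space p l\<^sub>1 l\<^sub>2 w) (morrey_norm p l\<^sub>1 l\<^sub>2 w)"
      unfolding w e_def by (intro maximal_bounded_strong \<beta> ab a) auto
  next
    assume bdd: "bounded_operator hl_maximal (morrey_space 1 l\<^sub>1 l\<^sub>2 w) (morrey_norm 1 l\<^sub>1 l\<^sub>2 w)
      (weak_morrey_space 1 l\<^sub>1 l\<^sub>2 w) (weak_morrey_norm 1 l\<^sub>1 l\<^sub>2 w)"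
    have "e \<le> 0 \<and> 0 < e + real DIM('a) * 1"
      unfolding e_def
    proof (rule bounded_operator_imp_exponents[OF \<beta> _ ab a bdd[unfolded w]])
      show "\<not> (\<forall>y. h y = \<infinity>)" if "h \<in> weak_morrey_space 1 l\<^sub>1 l\<^sub>2 (power_weight \<beta>)" for h :: "'a \<Rightarrow> ereal"
      proof
        assume "\<forall>y. h y = \<infinity>"
        then have "weak_morrey_norm 1 l\<^sub>1 l\<^sub>2 (power_weight \<beta>) h = top"
          by (intro weak_morrey_norm_infinite[OF refl \<beta> refl refl])
        with that show False by (simp add: weak_morrey_space_def)
      qed
    qed simp
    then show "e \<le> 0" "0 < e + real DIM('a) * 1" by auto
  next
    assume "e \<le> 0 \<and> 0 < e + real DIM('a) * 1"
    then show "bounded_operator hl_maximal (morrey_space 1 l\<^sub>1 l\<^sub>2 w) (morrey_norm 1 l\<^sub>1 l\<^sub>2 w)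
      (weak_morrey_space 1 l\<^sub>1 l\<^sub>2 w) (weak_morrey_norm 1 l\<^sub>1 l\<^sub>2 w)"
      unfolding w e_def by (intro maximal_bounded_weak \<beta> ab a) auto
  qed
qed

end
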